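(* Let $f:\Omega\to\mathbb{R}$ be a continuous potential satisfying the weak Walters condition, and consider $\mathscr{L}_f:C(\Omega)\to C(\Omega)$. Then there exist a real number $\lambda_f>0$, a strictly positive continuous function $h_f$, and a unique Borel probability measure $\nu_f$ such that (i) $\mathscr{L}_fh_f=\lambda_fh_f$ and $\mathscr{L}_f^*\nu_f=\lambda_f\nu_f$; (ii) for every $\varphi\in C(\Omega)$, $\big\|\lambda_f^{-n}\mathscr{L}_f^n\varphi-h_f\int_\Omega\varphi\,d\nu_f\big\|_0\to0$ as $n\to\infty$.
   Context: $(M,d)$ is a compact metric space and $\mu$ is a Borel probability measure on $M$ with $\operatorname{supp}\mu=M$. $\Omega=M^{\mathbb{N}}$ with metric $d_\Omega(x,y)=\sum_{n\ge1}2^{-n}d(x_n,y_n)$, $\sigma$ the left shift, $ax=(a,x_1,\dots)$ and $\mathbf{a}x=(a_1,\dots,a_n,x_1,\dots)$ for $\mathbf{a}\in M^n$. The Ruelle operator is $\mathscr{L}_f(\varphi)(x)=\int_M e^{f(ax)}\varphi(ax)\,d\mu(a)$ and $\mathscr{L}_f^*$ is its dual on Borel measures. $\|\cdot\|_0$ is the sup norm. $S_nf=\sum_{i=0}^{n-1}f\circ\sigma^i$; $C_f(x,y)=\sup_{n\ge1}\sup_{\mathbf{a}\in M^n}(S_nf(\mathbf{a}x)-S_nf(\mathbf{a}y))$; $f$ satisfies the weak Walters condition if $C_f(x,y)\to0$ as $d_\Omega(x,y)\to0$. *)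

theory Defs
  imports "HOL-Probability.Probability"
begin

text \<open>Points of Omega = M^N are sequences indexed from 0 (x 0 is the paper's x_1).
  The compact metric space M is the whole type 'a (assumed compact).\<close>

definition dOmega :: "(nat \<Rightarrow> 'a::metric_space) \<Rightarrow> (nat \<Rightarrow> 'a) \<Rightarrow> real" where
  "dOmega x y = (\<Sum>n. (1/2)^(Suc n) * dist (x n) (y n))"

definition cont_Omega :: "((nat \<Rightarrow> 'a::metric_space) \<Rightarrow> real) \<Rightarrow> bool" where
  "cont_Omega g \<longleftrightarrow> (\<forall>x. \<forall>e>0. \<exists>d>0. \<forall>y. dOmega x y < d \<longrightarrow> \<bar>g y - g x\<bar> < e)"

definition open_Omega :: "(nat \<Rightarrow> 'a::metric_space) set \<Rightarrow> bool" where
  "open_Omega U \<longleftrightarrow> (\<forall>x\<in>U. \<exists>e>0. \<forall>y. dOmega x y < e \<longrightarrow> y \<in> U)"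

definition borel_Omega :: "(nat \<Rightarrow> 'a::metric_space) measure" where
  "borel_Omega = sigma UNIV {U. open_Omega U}"

definition cons_seq :: "'a \<Rightarrow> (nat \<Rightarrow> 'a) \<Rightarrow> (nat \<Rightarrow> 'a)" where
  "cons_seq a x = (\<lambda>n. case n of 0 \<Rightarrow> a | Suc m \<Rightarrow> x m)"

text \<open>prepend n a x = (a_1,...,a_n,x_1,...), with a_i = a (i-1).\<close>
definition prepend :: "nat \<Rightarrow> (nat \<Rightarrow> 'a) \<Rightarrow> (nat \<Rightarrow> 'a) \<Rightarrow> (nat \<Rightarrow> 'a)" where
  "prepend n a x = (\<lambda>k. if k < n then a k else x (k - n))"

definition shift :: "(nat \<Rightarrow> 'a) \<Rightarrow> (nat \<Rightarrow> 'a)" where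
  "shift x = (\<lambda>k. x (Suc k))"

definition birkhoff_sum :: "((nat \<Rightarrow> 'a) \<Rightarrow> real) \<Rightarrow> nat \<Rightarrow> (nat \<Rightarrow> 'a) \<Rightarrow> real" where
  "birkhoff_sum f n x = (\<Sum>i<n. f ((shift ^^ i) x))"

definition walters_C :: "((nat \<Rightarrow> 'a) \<Rightarrow> real) \<Rightarrow> (nat \<Rightarrow> 'a) \<Rightarrow> (nat \<Rightarrow> 'a) \<Rightarrow> ereal" where
  "walters_C f x y = (SUP na \<in> {(n, a). (n::nat) \<ge> 1}.
      ereal (birkhoff_sum f (fst na) (prepend (fst na) (snd na) x)
           - birkhoff_sum f (fst na) (prepend (fst na) (snd na) y)))"

definition weak_walters :: "((nat \<Rightarrow> 'a::metric_space) \<Rightarrow> real) \<Rightarrow> bool" where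
  "weak_walters f \<longleftrightarrow> (\<forall>e>0. \<exists>d>0. \<forall>x y. dOmega x y < d \<longrightarrow> \<bar>walters_C f x y\<bar> < ereal e)"

definition ruelle :: "'a measure \<Rightarrow> ((nat \<Rightarrow> 'a) \<Rightarrow> real) \<Rightarrow> ((nat \<Rightarrow> 'a) \<Rightarrow> real) \<Rightarrow> (nat \<Rightarrow> 'a) \<Rightarrow> real" where
  "ruelle \<mu> f \<phi> x = (\<integral>a. exp (f (cons_seq a x)) * \<phi> (cons_seq a x) \<partial>\<mu>)"

definition full_support :: "'a::topological_space measure \<Rightarrow> bool" where
  "full_support \<mu> \<longleftrightarrow> (\<forall>U. open U \<and> U \<noteq> {} \<longrightarrow> emeasure \<mu> U > 0)"

text \<open>Dual eigen-equation L_f^* nu = lam nu, stated by testing against C(Omega).\<close>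
definition dual_eigen :: "'a measure \<Rightarrow> ((nat \<Rightarrow> 'a::metric_space) \<Rightarrow> real) \<Rightarrow> real \<Rightarrow> (nat \<Rightarrow> 'a) measure \<Rightarrow> bool" where
  "dual_eigen \<mu> f lam \<nu> \<longleftrightarrow>
     (\<forall>\<phi>. cont_Omega \<phi> \<longrightarrow> (\<integral>x. ruelle \<mu> f \<phi> x \<partial>\<nu>) = lam * (\<integral>x. \<phi> x \<partial>\<nu>))"

definition borel_prob_Omega :: "(nat \<Rightarrow> 'a::metric_space) measure \<Rightarrow> bool" where
  "borel_prob_Omega \<nu> \<longleftrightarrow> prob_space \<nu> \<and> sets \<nu> = sets borel_Omega \<and> space \<nu> = UNIV"

end

theory Submission
  imports Defs
begin

text \<open>Write \<open>r n \<phi> = L ^^ n \<phi> / L ^^ n 1\<close>. The weak Walters condition makes the functions \<open>r n \<phi>\<close>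
  equicontinuous and \<open>L ^^ n 1\<close> comparable to a constant, uniformly in \<open>n\<close>; since preimages are dense and
  \<open>\<mu>\<close> has full support, the oscillation of \<open>r n \<phi>\<close> tends to 0, uniformly over bounded equicontinuous
  families of \<open>\<phi>\<close>. As the suprema decrease and the infima increase in \<open>n\<close>, \<open>r n \<phi>\<close> converges uniformly
  to a constant \<open>E \<phi>\<close>. The functional \<open>E\<close> is positive, normalized and satisfies \<open>E (L \<phi>) = \<lambda> * E \<phi>\<close> with
  \<open>\<lambda> = E (L 1)\<close>; by the Riesz representation theorem it is integration against the eigenmeasure.
  Applied to the equicontinuous family \<open>L ^^ k 1 / \<lambda> ^ k\<close>, the uniform decay shows that this sequence is
  uniformly Cauchy, and its limit is the eigenfunction. No fixed point theorem is needed.\<close>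

section \<open>The Riesz representation theorem on compact metric spaces\<close>

text \<open>\<open>ratio n \<phi> x\<close> is a weighted average of \<open>\<phi>\<close> over the
  words of length \<open>n\<close> placed in front of \<open>x\<close>, the weights being
  proportional to the exponentials of Birkhoff sums. The obstacle is that the weak Walters condition
  gives a modulus of continuity without a rate, so there is nothing on which to build a spectral
  gap. A tolerance \<open>e\<close> is therefore conceded in each step: points near a minimum are
  known only to be within \<open>e\<close> of it, and both the number \<open>p\<close> of symbols
  that reach them and the contraction factor depend on \<open>e\<close>. What shrinks by the factor
  \<open>1 - c\<close> every \<open>p\<close> iterations is a bound on the excess of the oscillation
  over \<open>e\<close>, not the oscillation itself; as \<open>e\<close> is arbitrary, this gives
  convergence, without a rate. All estimates use the metric of the type
  \<open>nat \<Rightarrow> 'a\<close>, which for a compact alphabet is uniformly equivalent to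
  \<open>dOmega\<close>.\<close>

lemma continuous_on_compact_UNIV_bounded:
  fixes \<phi> :: "'a::metric_space \<Rightarrow> real"
  assumes "compact (UNIV :: 'a set)" "continuous_on UNIV \<phi>"
  obtains B where "\<forall>x. \<bar>\<phi> x\<bar> \<le> B"
  using compact_imp_bounded[OF compact_continuous_image[OF assms(2,1)]] unfolding bounded_iff by auto

lemma integrable_continuous_compact_UNIV:
  fixes \<phi> :: "'a::metric_space \<Rightarrow> real"
  assumes "compact (UNIV :: 'a set)" "continuous_on UNIV \<phi>" "finite_measure N" "sets N = sets borel"
  shows "integrable N \<phi>"
proof -
  interpret finite_measure N by fact
  obtain B where "\<forall>x. \<bar>\<phi> x\<bar> \<le> B"
    by (rule continuous_on_compact_UNIV_bounded[OF assms(1,2)])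
  moreover have "\<phi> \<in> borel_measurable N"
    unfolding measurable_cong_sets[OF assms(4) refl] by (rule borel_measurable_continuous_onI[OF assms(2)])
  ultimately show ?thesis
    by (intro integrable_const_bound[of _ B]) auto
qed

locale normalized_positive_functional =
  fixes I :: "('a::metric_space \<Rightarrow> real) \<Rightarrow> real"
  assumes compact_space: "compact (UNIV :: 'a set)"
    and add: "\<lbrakk>continuous_on UNIV \<phi>; continuous_on UNIV \<psi>\<rbrakk> \<Longrightarrow> I (\<lambda>x. \<phi> x + \<psi> x) = I \<phi> + I \<psi>"
    and scale: "continuous_on UNIV \<phi> \<Longrightarrow> I (\<lambda>x. c * \<phi> x) = c * I \<phi>"
    and nonneg: "\<lbrakk>continuous_on UNIV \<phi>; \<And>x. 0 \<le> \<phi> x\<rbrakk> \<Longrightarrow> 0 \<le> I \<phi>"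
    and one: "I (\<lambda>_. 1) = 1"
begin

lemma diff: "\<lbrakk>continuous_on UNIV \<phi>; continuous_on UNIV \<psi>\<rbrakk> \<Longrightarrow> I (\<lambda>x. \<phi> x - \<psi> x) = I \<phi> - I \<psi>"
  using add[of \<phi> "\<lambda>x. -1 * \<psi> x"] scale[of \<psi> "-1"] by (simp add: continuous_on_minus)

lemma const: "I (\<lambda>_. c) = c"
  using scale[of "\<lambda>_. 1" c] one by simp

lemma mono:
  assumes "continuous_on UNIV \<phi>" "continuous_on UNIV \<psi>" "\<And>x. \<phi> x \<le> \<psi> x"
  shows "I \<phi> \<le> I \<psi>"
  using diff[OF assms(2,1)] nonneg[of "\<lambda>x. \<psi> x - \<phi> x"] assms
  by (simp add: continuous_on_diff)

lemma sum_lessThan: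
  assumes "\<And>n. continuous_on UNIV (\<phi> n)"
  shows "I (\<lambda>x. \<Sum>n<(N::nat). \<phi> n x) = (\<Sum>n<N. I (\<phi> n))"
proof (induction N)
  case 0
  show ?case using const[of 0] by simp
next
  case (Suc N)
  show ?case
    using add[of "\<lambda>x. \<Sum>n<N. \<phi> n x" "\<phi> N"] Suc assms by (simp add: continuous_on_sum)
qed

text \<open>Functions instead of open sets serve as covers, in the manner of Daniell: the functional
  evaluates them directly, and no premeasure on open sets has to be built first. The sum is taken in
  \<open>ennreal\<close>, so it may diverge.\<close>

definition cover :: "'a set \<Rightarrow> (nat \<Rightarrow> 'a \<Rightarrow> real) set" where
  "cover A = {\<phi>. (\<forall>n. continuous_on UNIV (\<phi> n) \<and> (\<forall>x. 0 \<le> \<phi> n x)) \<and>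
     (\<forall>x\<in>A. 1 \<le> (\<Sum>n. ennreal (\<phi> n x)))}"

definition outer :: "'a set \<Rightarrow> ennreal" where
  "outer A = (INF \<phi>\<in>cover A. \<Sum>n. ennreal (I (\<phi> n)))"

lemma coverD:
  assumes "\<phi> \<in> cover A"
  shows "continuous_on UNIV (\<phi> n)" "0 \<le> \<phi> n x" "0 \<le> I (\<phi> n)" "x \<in> A \<Longrightarrow> 1 \<le> (\<Sum>n. ennreal (\<phi> n x))"
proof -
  show *: "continuous_on UNIV (\<phi> n)" "0 \<le> \<phi> n x" for n x
    using assms by (simp_all add: cover_def)
  show "0 \<le> I (\<phi> n)" by (rule nonneg[OF *])
  show "1 \<le> (\<Sum>n. ennreal (\<phi> n x))" if "x \<in> A"
    using assms that by (simp add: cover_def)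
qed

lemma outer_le_suminf:
  assumes "\<And>n. continuous_on UNIV (\<phi> n)" "\<And>n x. 0 \<le> \<phi> n x"
    and "\<And>x. x \<in> A \<Longrightarrow> 1 \<le> (\<Sum>n. ennreal (\<phi> n x))"
  shows "outer A \<le> (\<Sum>n. ennreal (I (\<phi> n)))"
  unfolding outer_def by (rule INF_lower) (simp add: cover_def assms)

lemma outer_le_suminf2:
  assumes "\<And>m n. continuous_on UNIV (\<phi> m n)" "\<And>m n x. 0 \<le> \<phi> m n x"
    and "\<And>x. x \<in> A \<Longrightarrow> 1 \<le> (\<Sum>m. \<Sum>n. ennreal (\<phi> m n x))"
  shows "outer A \<le> (\<Sum>m. \<Sum>n. ennreal (I (\<phi> m n)))"
proof -
  let ?\<Phi> = "\<lambda>i. \<phi> (fst (prod_decode i)) (snd (prod_decode i))"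
  have sum_x: "(\<Sum>i. ennreal (?\<Phi> i x)) = (\<Sum>m. \<Sum>n. ennreal (\<phi> m n x))" for x
    using suminf_ennreal_2dimen[of "\<lambda>m. \<Sum>n. ennreal (\<phi> m n x)" "\<lambda>p. ennreal (\<phi> (fst p) (snd p) x)"]
    by simp
  have "outer A \<le> (\<Sum>i. ennreal (I (?\<Phi> i)))"
    by (rule outer_le_suminf) (simp_all only: assms sum_x)
  also have "\<dots> = (\<Sum>m. \<Sum>n. ennreal (I (\<phi> m n)))"
    using suminf_ennreal_2dimen[of "\<lambda>m. \<Sum>n. ennreal (I (\<phi> m n))" "\<lambda>p. ennreal (I (\<phi> (fst p) (snd p)))"]
    by simp
  finally show ?thesis .
qed

lemma outer_le:
  assumes "continuous_on UNIV \<phi>" "\<And>x. 0 \<le> \<phi> x" "\<And>x. x \<in> A \<Longrightarrow> 1 \<le> \<phi> x"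
  shows "outer A \<le> ennreal (I \<phi>)"
proof -
  have *: "(\<Sum>n. ennreal (if n = 0 then c else 0)) = ennreal c" for c :: real
    by (subst suminf_finite[of "{0}"]) auto
  have "(\<Sum>n. ennreal (I (\<lambda>x. if n = 0 then \<phi> x else 0))) = (\<Sum>n. ennreal (if n = 0 then I \<phi> else 0))"
    by (intro suminf_cong) (use const[of 0] in auto)
  moreover have "outer A \<le> (\<Sum>n. ennreal (I (\<lambda>x. if n = (0::nat) then \<phi> x else 0)))"
  proof (rule outer_le_suminf)
    show "continuous_on UNIV (\<lambda>x. if n = (0::nat) then \<phi> x else 0)" for n
      using assms(1) by (cases "n = 0") auto
    show "0 \<le> (if n = (0::nat) then \<phi> x else 0)" for n x
      using assms(2) by simp
    show "1 \<le> (\<Sum>n. ennreal (if n = (0::nat) then \<phi> x else 0))" if "x \<in> A" for x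
      unfolding * using assms(3)[OF that] by simp
  qed
  ultimately show ?thesis by (simp add: *)
qed

lemma outer_mono: "A \<subseteq> B \<Longrightarrow> outer A \<le> outer B"
  unfolding outer_def by (intro INF_superset_mono) (auto simp: cover_def)

lemma outer_empty: "outer {} = 0"
  using outer_le[of "\<lambda>_. 0" "{}"] const[of 0] by simp

lemma outer_Union_le: "outer (\<Union>i. A i) \<le> (\<Sum>i. outer (A i))"
proof (rule ennreal_le_epsilon)
  fix e :: real assume "0 < e" and fin: "(\<Sum>i. outer (A i)) < top"
  have "\<exists>\<phi>\<in>cover (A i). (\<Sum>n. ennreal (I (\<phi> n))) \<le> outer (A i) + ennreal (e * (1/2)^Suc i)" for i
  proof -
    have "outer (A i) < top"
      using fin ennreal_suminf_lessD by blast
    then have "outer (A i) < outer (A i) + ennreal (e * (1/2)^Suc i)"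
      using \<open>0 < e\<close> by (simp add: ennreal_add_left_cancel_less)
    then show ?thesis
      using INF_less_iff[of "\<lambda>\<phi>. \<Sum>n. ennreal (I (\<phi> n))" "cover (A i)"]
      unfolding outer_def by (metis less_imp_le)
  qed
  then obtain \<phi> where \<phi>: "\<And>i. \<phi> i \<in> cover (A i)"
    "\<And>i. (\<Sum>n. ennreal (I (\<phi> i n))) \<le> outer (A i) + ennreal (e * (1/2)^Suc i)"
    by metis
  have "outer (\<Union>i. A i) \<le> (\<Sum>m. \<Sum>n. ennreal (I (\<phi> m n)))"
  proof (rule outer_le_suminf2)
    fix x assume "x \<in> (\<Union>i. A i)"
    then obtain j where "x \<in> A j" by auto
    then have "1 \<le> (\<Sum>n. ennreal (\<phi> j n x))" using coverD(4)[OF \<phi>(1)] by blast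
    also have "\<dots> \<le> (\<Sum>m. \<Sum>n. ennreal (\<phi> m n x))"
      using sum_le_suminf[of "\<lambda>m. \<Sum>n. ennreal (\<phi> m n x)" "{j}"] by simp
    finally show "1 \<le> (\<Sum>m. \<Sum>n. ennreal (\<phi> m n x))" .
  qed (rule coverD(1,2)[OF \<phi>(1)])+
  also have "\<dots> \<le> (\<Sum>i. outer (A i) + ennreal (e * (1/2)^Suc i))"
    by (intro suminf_le \<phi>(2)) auto
  also have "\<dots> = (\<Sum>i. outer (A i)) + (\<Sum>i. ennreal (e * (1/2)^Suc i))"
    by (intro suminf_add[symmetric]) auto
  also have "(\<Sum>i. ennreal (e * (1/2)^Suc i)) = ennreal e"
    using sums_mult[OF power_half_series, of e] \<open>0 < e\<close> by (intro suminf_ennreal_eq) auto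
  finally show "outer (\<Union>i. A i) \<le> (\<Sum>i. outer (A i)) + ennreal e" .
qed

text \<open>A cover \<open>\<phi>\<close> of \<open>X\<close> is split by the cut-offs \<open>min 1 (k * \<psi>)\<close>, which increase to the indicator
  of the support of \<open>\<psi>\<close>; the level \<open>k\<close> may depend on the member of the cover.\<close>

lemma outer_split_support:
  fixes \<psi> :: "'a \<Rightarrow> real"
  assumes \<psi>: "continuous_on UNIV \<psi>" "\<And>x. 0 \<le> \<psi> x"
  shows "outer (X \<inter> {x. 0 < \<psi> x}) + outer (X - {x. 0 < \<psi> x}) \<le> outer X"
  unfolding outer_def[of X]
proof (rule INF_greatest)
  fix \<phi> assume "\<phi> \<in> cover X"
  note \<phi> = coverD[OF this]
  define cut where "cut k x = min 1 (real k * \<psi> x)" for k x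
  have cut: "continuous_on UNIV (cut k)" "0 \<le> cut k x" "cut k x \<le> 1" "cut k x \<le> cut (Suc k) x" for k x
    using \<psi> by (auto simp: cut_def intro!: continuous_intros min.coboundedI2 mult_right_mono)
  have cut_lim: "(\<lambda>k. cut k x) \<longlonglongrightarrow> 1" if "0 < \<psi> x" for x
  proof (rule tendsto_eventually, rule eventually_sequentiallyI)
    fix k assume "nat \<lceil>1 / \<psi> x\<rceil> \<le> k"
    then have "1 / \<psi> x \<le> real k" by linarith
    then show "cut k x = 1" using that by (simp add: cut_def field_simps)
  qed
  \<comment> \<open>\<open>J n\<close> stands for the integral of \<open>\<phi> n\<close> over
    \<open>{x. 0 < \<psi> x}\<close>, reached as a limit because the functional accepts continuous
    functions, not indicators.\<close>
  define J where "J n = (SUP k. I (\<lambda>x. \<phi> n x * cut k x))" for n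
  have mono': "I (\<lambda>x. \<phi> n x * cut k x) \<le> I (\<lambda>x. \<phi> n x * cut (Suc k) x)" for n k
    using \<phi> cut by (intro mono continuous_intros mult_left_mono)
  have le: "I (\<lambda>x. \<phi> n x * cut k x) \<le> I (\<phi> n)" for n k
    using \<phi> cut by (intro mono continuous_intros) (auto intro: mult_left_le)
  have J_lim: "(\<lambda>k. I (\<lambda>x. \<phi> n x * cut k x)) \<longlonglongrightarrow> J n" for n
    unfolding J_def by (intro LIMSEQ_incseq_SUP incseq_SucI bdd_aboveI2[of _ _ "I (\<phi> n)"] mono' le)
  have J_ge0: "0 \<le> J n" for n
    by (intro LIMSEQ_le_const[OF J_lim] exI[of _ 0] allI impI nonneg continuous_intros mult_nonneg_nonneg \<phi> cut)
  have J_le: "J n \<le> I (\<phi> n)" for n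
    by (intro LIMSEQ_le_const2[OF J_lim]) (use le in auto)
  \<comment> \<open>Since \<open>cut 0\<close> vanishes, on the support \<open>\<phi> n\<close> is
    the telescoping series of \<open>\<phi> n x * (cut (Suc k) x - cut k x)\<close>. This is a cover
    by continuous functions whose values under \<open>I\<close> add up to \<open>J n\<close> for
    each \<open>n\<close>.\<close>
  have 1: "outer (X \<inter> {x. 0 < \<psi> x}) \<le> (\<Sum>n. ennreal (J n))"
  proof -
    have "outer (X \<inter> {x. 0 < \<psi> x}) \<le> (\<Sum>n. \<Sum>k. ennreal (I (\<lambda>x. \<phi> n x * (cut (Suc k) x - cut k x))))"
    proof (rule outer_le_suminf2)
      fix x assume x: "x \<in> X \<inter> {x. 0 < \<psi> x}"
      have "(\<Sum>k. ennreal (\<phi> n x * (cut (Suc k) x - cut k x))) = ennreal (\<phi> n x)" for n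
      proof (rule suminf_ennreal_eq)
        show "(\<lambda>k. \<phi> n x * (cut (Suc k) x - cut k x)) sums \<phi> n x"
          using sums_mult[OF telescope_sums[OF cut_lim], of x "\<phi> n x"] x by (simp add: cut_def)
      qed (use \<phi> cut in auto)
      then show "1 \<le> (\<Sum>n. \<Sum>k. ennreal (\<phi> n x * (cut (Suc k) x - cut k x)))"
        using \<phi>(4) x by simp
    qed (use \<phi> cut in \<open>auto intro!: continuous_intros\<close>)
    also have "(\<lambda>n. \<Sum>k. ennreal (I (\<lambda>x. \<phi> n x * (cut (Suc k) x - cut k x)))) = (\<lambda>n. ennreal (J n))"
    proof (rule ext)
      fix n
      show "(\<Sum>k. ennreal (I (\<lambda>x. \<phi> n x * (cut (Suc k) x - cut k x)))) = ennreal (J n)"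
      proof (rule suminf_ennreal_eq)
      have "I (\<lambda>x. \<phi> n x * (cut (Suc k) x - cut k x)) = I (\<lambda>x. \<phi> n x * cut (Suc k) x) - I (\<lambda>x. \<phi> n x * cut k x)" for k
        unfolding right_diff_distrib using \<phi> cut by (intro diff continuous_intros)
      moreover have "I (\<lambda>x. \<phi> n x * cut 0 x) = 0"
        using const[of 0] \<psi>(2) by (simp add: cut_def)
      ultimately show "(\<lambda>k. I (\<lambda>x. \<phi> n x * (cut (Suc k) x - cut k x))) sums J n"
        using telescope_sums[OF J_lim, of n] by simp
      qed (use \<phi> cut in \<open>auto intro!: nonneg continuous_intros\<close>)
    qed
    finally show ?thesis .
  qed
  show "outer (X \<inter> {x. 0 < \<psi> x}) + outer (X - {x. 0 < \<psi> x}) \<le> (\<Sum>n. ennreal (I (\<phi> n)))"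
  proof (rule ennreal_le_epsilon)
    fix e :: real assume "0 < e"
    \<comment> \<open>Off the support all cut-offs vanish, so subtracting any one of them still
      leaves a cover of the remainder. The level is chosen separately for each \<open>n\<close> so
      that the errors sum to at most \<open>e\<close>.\<close>
    have "\<exists>k. J n - e * (1/2)^Suc n < I (\<lambda>x. \<phi> n x * cut k x)" for n
      using order_tendstoD(1)[OF J_lim, of "J n - e * (1/2)^Suc n" n] \<open>0 < e\<close>
      by (auto simp: eventually_sequentially)
    then obtain k where k: "\<And>n. J n - e * (1/2)^Suc n < I (\<lambda>x. \<phi> n x * cut (k n) x)"
      by metis
    have "outer (X - {x. 0 < \<psi> x}) \<le> (\<Sum>n. ennreal (I (\<lambda>x. \<phi> n x - \<phi> n x * cut (k n) x)))"
    proof (rule outer_le_suminf)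
      fix x assume x: "x \<in> X - {x. 0 < \<psi> x}"
      then have "\<psi> x = 0" using \<psi>(2)[of x] by auto
      then show "1 \<le> (\<Sum>n. ennreal (\<phi> n x - \<phi> n x * cut (k n) x))"
        using \<phi>(4) x by (simp add: cut_def)
    qed (use \<phi> cut in \<open>auto intro!: continuous_intros mult_left_le\<close>)
    also have "\<dots> \<le> (\<Sum>n. ennreal (I (\<phi> n) - J n + e * (1/2)^Suc n))"
    proof (intro suminf_le ennreal_leI)
      fix n
      have "I (\<lambda>x. \<phi> n x - \<phi> n x * cut (k n) x) = I (\<phi> n) - I (\<lambda>x. \<phi> n x * cut (k n) x)"
        using \<phi> cut by (intro diff continuous_intros)
      then show "I (\<lambda>x. \<phi> n x - \<phi> n x * cut (k n) x) \<le> I (\<phi> n) - J n + e * (1/2)^Suc n"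
        using k[of n] by simp
    qed auto
    finally have "outer (X \<inter> {x. 0 < \<psi> x}) + outer (X - {x. 0 < \<psi> x})
      \<le> (\<Sum>n. ennreal (J n)) + (\<Sum>n. ennreal (I (\<phi> n) - J n + e * (1/2)^Suc n))"
      by (intro add_mono 1)
    also have "\<dots> = (\<Sum>n. ennreal (I (\<phi> n)) + ennreal (e * (1/2)^Suc n))"
      using J_ge0 J_le \<open>0 < e\<close> \<phi>(3)
      by (subst suminf_add) (auto intro!: suminf_cong simp flip: ennreal_plus)
    also have "\<dots> = (\<Sum>n. ennreal (I (\<phi> n))) + (\<Sum>n. ennreal (e * (1/2)^Suc n))"
      by (intro suminf_add[symmetric]) auto
    also have "(\<Sum>i. ennreal (e * (1/2)^Suc i)) = ennreal e"
      using sums_mult[OF power_half_series, of e] \<open>0 < e\<close> by (intro suminf_ennreal_eq) auto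
    finally show "outer (X \<inter> {x. 0 < \<psi> x}) + outer (X - {x. 0 < \<psi> x}) \<le> (\<Sum>n. ennreal (I (\<phi> n))) + ennreal e" .
  qed
qed

text \<open>The lower bound is a Dini argument: partial sums of a cover are continuous and
  increasing, so by compactness finitely many terms already reach \<open>1 - e\<close> everywhere,
  and on finite sums the functional is additive and monotone.\<close>

lemma outer_UNIV: "outer UNIV = 1"
proof (rule antisym)
  show "outer UNIV \<le> 1"
    using outer_le[of "\<lambda>_. 1" UNIV] one by simp
  show "1 \<le> outer UNIV"
    unfolding outer_def
  proof (rule INF_greatest)
    fix \<phi> assume "\<phi> \<in> cover UNIV"
    note \<phi> = coverD[OF this]
    show "1 \<le> (\<Sum>n. ennreal (I (\<phi> n)))"
    proof (rule ennreal_le_epsilon)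
      fix e :: real assume e: "0 < e"
      define U where "U N = {x. 1 - e < (\<Sum>n<N. \<phi> n x)}" for N
      have U_open: "open (U N)" for N
        unfolding U_def using \<phi>(1) by (intro open_Collect_less continuous_intros)
      have U_cover: "\<exists>N. x \<in> U N" for x
      proof -
        have "ennreal (1 - e) < 1" using e by (simp add: ennreal_less_one_iff)
        also have "1 \<le> (\<Sum>n. ennreal (\<phi> n x))" using \<phi>(4) by simp
        finally have "ennreal (1 - e) < (SUP N. \<Sum>n<N. ennreal (\<phi> n x))"
          by (simp add: suminf_eq_SUP)
        then obtain N where "ennreal (1 - e) < (\<Sum>n<N. ennreal (\<phi> n x))"
          by (auto simp: less_SUP_iff)
        then have "ennreal (1 - e) < ennreal (\<Sum>n<N. \<phi> n x)"
          using \<phi>(2) by (simp add: sum_ennreal)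
        then have "x \<in> U N"
          unfolding U_def using ennreal_leI[of "\<Sum>n<N. \<phi> n x" "1 - e"] by (auto simp: not_le[symmetric])
        then show ?thesis by blast
      qed
      obtain T where T: "finite T" "UNIV \<subseteq> (\<Union>N\<in>T. U N)"
        by (rule compactE_image[OF compact_space, of UNIV U]) (use U_open U_cover in auto)
      define N where "N = Max (insert 0 T)"
      have "1 - e \<le> (\<Sum>n<N. \<phi> n x)" for x
      proof -
        obtain m where "m \<in> T" "x \<in> U m" using T(2) by blast
        have "m \<le> N" unfolding N_def using T(1) \<open>m \<in> T\<close> by (intro Max_ge) auto
        then have "(\<Sum>n<m. \<phi> n x) \<le> (\<Sum>n<N. \<phi> n x)"
          using \<phi>(2) by (intro sum_mono2) auto
        then show ?thesis using \<open>x \<in> U m\<close> by (simp add: U_def)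
      qed
      then have "1 - e \<le> I (\<lambda>x. \<Sum>n<N. \<phi> n x)"
        using mono[of "\<lambda>_. 1 - e" "\<lambda>x. \<Sum>n<N. \<phi> n x"] const \<phi>(1) by (simp add: continuous_on_sum)
      then have "1 \<le> ennreal ((\<Sum>n<N. I (\<phi> n)) + e)"
        using sum_lessThan[OF \<phi>(1)] by simp
      also have "\<dots> = (\<Sum>n<N. ennreal (I (\<phi> n))) + ennreal e"
        using \<phi>(3) e by (simp add: sum_nonneg sum_ennreal)
      also have "\<dots> \<le> (\<Sum>n. ennreal (I (\<phi> n))) + ennreal e"
        by (intro add_mono sum_le_suminf) auto
      finally show "1 \<le> (\<Sum>n. ennreal (I (\<phi> n))) + ennreal e" .
    qed
  qed
qed

lemma outer_measure_space_outer: "outer_measure_space UNIV outer"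
  unfolding outer_measure_space_def positive_def increasing_def countably_subadditive_def
  by (intro conjI ballI allI impI outer_empty outer_mono outer_Union_le)

lemma open_in_lambda_system:
  assumes "open U" shows "U \<in> lambda_system UNIV UNIV outer"
proof -
  \<comment> \<open>The distance to the complement is positive exactly on \<open>U\<close>. The
    whole space is treated apart because \<open>infdist\<close> to the empty set is 0.\<close>
  define \<psi> where "\<psi> x = (if U = UNIV then 1 else infdist x (- U))" for x
  have "continuous_on UNIV \<psi>"
    unfolding \<psi>_def by (cases "U = UNIV") (auto intro!: continuous_intros)
  moreover have "0 \<le> \<psi> x" for x by (simp add: \<psi>_def infdist_nonneg)
  moreover have "{x. 0 < \<psi> x} = U"
  proof (cases "U = UNIV")
    case False
    then have "infdist x (- U) = 0 \<longleftrightarrow> x \<notin> U" for x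
      using in_closed_iff_infdist_zero[of "- U" x] assms by (auto simp: closed_Compl)
    then show ?thesis
      using False infdist_nonneg[of _ "- U"] by (auto simp: \<psi>_def less_le)
  qed (simp add: \<psi>_def)
  ultimately have "outer (X \<inter> U) + outer (X - U) \<le> outer X" for X
    using outer_split_support[of \<psi> X] by simp
  moreover have "outer X \<le> outer (X \<inter> U) + outer (X - U)" for X
  proof -
    have "subadditive UNIV outer"
      using outer_measure_space_outer ring_of_sets.countably_subadditive_subadditive[of UNIV UNIV outer]
        algebra.axioms(1)[OF sigma_algebra.axioms(1)[OF sigma_algebra_Pow[of UNIV]]]
      unfolding outer_measure_space_def by simp
    then have "outer ((X \<inter> U) \<union> (X - U)) \<le> outer (X \<inter> U) + outer (X - U)"
      by (rule subadditiveD) auto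
    then show ?thesis by (simp add: Int_Diff_Un)
  qed
  ultimately show ?thesis
    using algebra.lambda_system_eq[OF sigma_algebra.axioms(1)[OF sigma_algebra_Pow[of UNIV]], of outer]
    by (simp add: antisym)
qed

definition riesz_measure :: "'a measure" where
  "riesz_measure = measure_of UNIV (sets borel) outer"

lemma sets_riesz_measure[simp, measurable_cong]: "sets riesz_measure = sets borel"
  unfolding riesz_measure_def by (metis sets.sets_measure_of_eq space_borel)

lemma space_riesz_measure[simp]: "space riesz_measure = UNIV"
  by (metis sets_eq_imp_space_eq sets_riesz_measure space_borel)

lemma emeasure_riesz_measure:
  assumes "A \<in> sets borel" shows "emeasure riesz_measure A = outer A"
proof -
  have ms: "measure_space UNIV (lambda_system UNIV UNIV outer) outer"
    using sigma_algebra.caratheodory_lemma[OF sigma_algebra_Pow[of UNIV, unfolded Pow_UNIV] outer_measure_space_outer] .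
  then have "sigma_algebra UNIV (lambda_system UNIV UNIV outer)"
    by (simp add: measure_space_def)
  then have "sets (borel :: 'a measure) \<subseteq> lambda_system UNIV UNIV outer"
    unfolding borel_def sets_measure_of[OF subset_UNIV[of "{S. open S}", folded Pow_UNIV]]
    by (intro sigma_algebra.sigma_sets_subset) (auto intro: open_in_lambda_system)
  then have "measure_space UNIV (sets borel) outer"
    using measure_down[OF ms] sets.sigma_algebra_axioms[of "borel :: 'a measure"] by simp
  then show ?thesis
    using assms unfolding riesz_measure_def
    by (intro emeasure_measure_of_sigma) (auto simp: measure_space_def)
qed

lemma prob_space_riesz_measure: "prob_space riesz_measure"
  by (rule prob_spaceI) (simp add: emeasure_riesz_measure outer_UNIV)

text \<open>Slicing \<open>\<phi>\<close> into layers of height \<open>1/n\<close>: the rescaled \<open>j\<close>-th layer dominates the indicator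
  of a superlevel set, hence bounds its measure.\<close>

lemma integral_riesz_measure_le:
  assumes \<phi>: "continuous_on UNIV \<phi>" "\<And>x. 0 \<le> \<phi> x"
  shows "(\<integral>x. \<phi> x \<partial>riesz_measure) \<le> I \<phi>"
proof -
  interpret N: prob_space riesz_measure by (rule prob_space_riesz_measure)
  obtain B where "\<forall>x. \<bar>\<phi> x\<bar> \<le> B"
    by (rule continuous_on_compact_UNIV_bounded[OF compact_space \<phi>(1)])
  then have B: "\<phi> x \<le> B" for x by (meson abs_le_D1)
  have "(\<integral>x. \<phi> x \<partial>riesz_measure) \<le> I \<phi> + 1 / real (Suc i)" for i
  proof -
    define n where "n = real (Suc i)"
    have n: "0 < n" by (simp add: n_def)
    obtain m :: nat where m: "B * n \<le> real m" using real_arch_simple by blast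
    define l where "l j x = min (\<phi> x) (real (Suc j) / n) - min (\<phi> x) (real j / n)" for j x
    define A where "A j = {x. real (Suc j) / n \<le> \<phi> x}" for j
    have l_cont: "continuous_on UNIV (l j)" for j
      unfolding l_def by (intro continuous_intros \<phi>(1))
    have l_nonneg: "0 \<le> l j x" and l_le: "l j x \<le> 1 / n" for j x
      using n by (auto simp: l_def min_def field_simps)
    \<comment> \<open>Shift of index: layer \<open>j + 1\<close> can be nonzero only on
      \<open>A j\<close>, where layer \<open>j\<close> has its full height \<open>1 / n\<close>. The
      former bounds the integral by measures of the \<open>A j\<close>, the latter bounds these
      measures by \<open>I (l j)\<close>; only layer 0, of height \<open>1 / n\<close>, is
      lost.\<close>
    have l_le': "l (Suc j) x \<le> 1 / n * indicator (A j) x" for j x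
      using l_le[of "Suc j" x] n
      by (cases "x \<in> A j") (auto simp: A_def l_def min_def field_simps)
    have A_meas: "A j \<in> sets borel" for j
      unfolding A_def using \<phi>(1) by (intro borel_closed closed_Collect_le continuous_intros)
    have A_int: "integrable riesz_measure (indicat_real (A j))" for j
      using A_meas by (intro integrable_real_indicator) (auto simp: less_top[symmetric])
    have A_le: "1 / n * measure riesz_measure (A j) \<le> I (l j)" for j
    proof -
      have "outer (A j) \<le> ennreal (I (\<lambda>x. n * l j x))"
      proof (rule outer_le)
        fix x assume "x \<in> A j"
        then have "l j x = 1 / n"
          using n by (auto simp: A_def l_def min_def field_simps)
        then show "1 \<le> n * l j x" using n by simp
      qed (use n l_cont l_nonneg in \<open>auto intro!: continuous_intros\<close>)
      then have "emeasure riesz_measure (A j) \<le> ennreal (n * I (l j))"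
        by (simp add: emeasure_riesz_measure[OF A_meas] scale[OF l_cont])
      then have "measure riesz_measure (A j) \<le> n * I (l j)"
        using n nonneg[OF l_cont l_nonneg] by (simp add: N.emeasure_eq_measure)
      then show ?thesis using n by (simp add: field_simps)
    qed
    have sum_l: "(\<Sum>j<k. l j x) = min (\<phi> x) (real k / n)" for k x
      unfolding l_def using \<phi>(2) by (subst sum_lessThan_telescope) simp
    have \<phi>_le: "\<phi> x \<le> 1 / n + (\<Sum>j<m. 1 / n * indicator (A j) x)" for x
    proof -
      have "\<phi> x * n \<le> real (Suc m)"
        using mult_right_mono[OF B[of x], of n] m n by linarith
      then have "\<phi> x \<le> real (Suc m) / n" using n by (simp add: field_simps)
      then have "\<phi> x = (\<Sum>j<Suc m. l j x)" unfolding sum_l by simp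
      also have "\<dots> = l 0 x + (\<Sum>j<m. l (Suc j) x)" by (rule sum.lessThan_Suc_shift)
      also have "\<dots> \<le> 1 / n + (\<Sum>j<m. 1 / n * indicator (A j) x)"
        by (intro add_mono sum_mono l_le l_le')
      finally show ?thesis .
    qed
    have "(\<integral>x. \<phi> x \<partial>riesz_measure) \<le> (\<integral>x. 1 / n + (\<Sum>j<m. 1 / n * indicator (A j) x) \<partial>riesz_measure)"
    proof (rule integral_mono[OF _ _ \<phi>_le])
      show "integrable riesz_measure \<phi>"
        using integrable_continuous_compact_UNIV[OF compact_space \<phi>(1) N.finite_measure_axioms] by simp
      show "integrable riesz_measure (\<lambda>x. 1 / n + (\<Sum>j<m. 1 / n * indicator (A j) x))"
        using A_int by (intro Bochner_Integration.integrable_add Bochner_Integration.integrable_sum integrable_mult_right) auto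
    qed
    also have "\<dots> = 1 / n + (\<Sum>j<m. 1 / n * measure riesz_measure (A j))"
      using A_int N.prob_space by (simp add: Bochner_Integration.integral_sum)
    also have "\<dots> \<le> 1 / n + (\<Sum>j<m. I (l j))"
      by (intro add_left_mono sum_mono A_le)
    also have "(\<Sum>j<m. I (l j)) = I (\<lambda>x. min (\<phi> x) (real m / n))"
      using sum_lessThan[of l m] l_cont sum_l by simp
    also have "\<dots> \<le> I \<phi>"
      by (intro mono continuous_intros \<phi>(1)) auto
    finally show ?thesis by (simp add: n_def)
  qed
  then show ?thesis
    using LIMSEQ_le_const[of "\<lambda>i. I \<phi> + 1 / real (Suc i)" "I \<phi>"]
      tendsto_add[OF tendsto_const[of "I \<phi>"] LIMSEQ_inverse_real_of_nat]
    by (simp add: inverse_eq_divide)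
qed

text \<open>The one-sided estimate suffices: applied to \<open>B + \<phi>\<close> and
  \<open>B - \<phi>\<close> it bounds the integral from above and from below.\<close>

lemma integral_riesz_measure:
  assumes \<phi>: "continuous_on UNIV \<phi>"
  shows "(\<integral>x. \<phi> x \<partial>riesz_measure) = I \<phi>"
proof -
  interpret N: prob_space riesz_measure by (rule prob_space_riesz_measure)
  obtain B where B: "\<forall>x. \<bar>\<phi> x\<bar> \<le> B"
    by (rule continuous_on_compact_UNIV_bounded[OF compact_space \<phi>])
  have B': "0 \<le> B + \<phi> x" "0 \<le> B - \<phi> x" for x using spec[OF B, of x] by auto
  have int: "integrable riesz_measure \<phi>"
    using integrable_continuous_compact_UNIV[OF compact_space \<phi> N.finite_measure_axioms] by simp
  have "(\<integral>x. B + \<phi> x \<partial>riesz_measure) \<le> I (\<lambda>x. B + \<phi> x)"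
    using B' \<phi> by (intro integral_riesz_measure_le continuous_intros)
  moreover have "(\<integral>x. B - \<phi> x \<partial>riesz_measure) \<le> I (\<lambda>x. B - \<phi> x)"
    using B' \<phi> by (intro integral_riesz_measure_le continuous_intros)
  ultimately show ?thesis
    using int add[of "\<lambda>_. B" \<phi>] diff[of "\<lambda>_. B" \<phi>] const[of B] \<phi> N.prob_space by simp
qed

end

text \<open>The functions \<open>min 1 (k * infdist x (- U))\<close> converge boundedly to the
  indicator of an open \<open>U\<close>, so dominated convergence recovers the measure of open sets,
  an intersection-stable generator of the Borel sets.\<close>

lemma measure_eqI_continuous:
  fixes N N' :: "'a::metric_space measure"
  assumes "prob_space N" "prob_space N'" "sets N = sets borel" "sets N' = sets borel"
    and eq: "\<And>\<phi> :: 'a \<Rightarrow> real. continuous_on UNIV \<phi> \<Longrightarrow> (\<integral>x. \<phi> x \<partial>N) = (\<integral>x. \<phi> x \<partial>N')"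
  shows "N = N'"
proof (rule measure_eqI_generator_eq[where E = "{U. open U}" and \<Omega> = UNIV and A = "\<lambda>_. UNIV"])
  interpret N: prob_space N by fact
  interpret N': prob_space N' by fact
  show "Int_stable {U :: 'a set. open U}" by (auto simp: Int_stable_def)
  show "sets N = sigma_sets UNIV {U. open U}" "sets N' = sigma_sets UNIV {U. open U}"
    using assms(3,4) by (simp_all add: borel_def)
  fix U :: "'a set" assume "U \<in> {U. open U}"
  then have U: "open U" by simp
  show "emeasure N U = emeasure N' U"
  proof (cases "U = UNIV")
    case True
    then show ?thesis
      using N.emeasure_space_1 N'.emeasure_space_1 sets_eq_imp_space_eq[OF assms(3)] sets_eq_imp_space_eq[OF assms(4)] by simp
  next
    case False
    define \<phi> where "\<phi> k x = min 1 (real k * infdist x (- U))" for k :: nat and x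
    have cont: "continuous_on UNIV (\<phi> k)" for k
      unfolding \<phi>_def by (intro continuous_intros)
    have bd: "\<bar>\<phi> k x\<bar> \<le> 1" for k x
      using mult_nonneg_nonneg[OF of_nat_0_le_iff[of k] infdist_nonneg[of x "- U"]]
      unfolding \<phi>_def by linarith
    have lim: "(\<lambda>k. \<phi> k x) \<longlonglongrightarrow> indicator U x" for x
    proof (cases "x \<in> U")
      case True
      then have pos: "0 < infdist x (- U)"
        using in_closed_iff_infdist_zero[of "- U" x] False U infdist_nonneg[of x "- U"]
        by (auto simp: closed_Compl less_le)
      have "\<phi> k x = 1" if "nat \<lceil>1 / infdist x (- U)\<rceil> \<le> k" for k
      proof -
        have "1 / infdist x (- U) \<le> real k" using that by linarith
        then show ?thesis using pos by (simp add: \<phi>_def field_simps)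
      qed
      then show ?thesis
        using True by (intro tendsto_eventually eventually_sequentiallyI[of "nat \<lceil>1 / infdist x (- U)\<rceil>"]) simp
    qed (simp add: \<phi>_def)
    have *: "(\<lambda>k. \<integral>x. \<phi> k x \<partial>P) \<longlonglongrightarrow> measure P U" if "prob_space P" "sets P = sets borel" for P
    proof -
      interpret P: prob_space P by fact
      have [measurable]: "U \<in> sets P" "\<phi> k \<in> borel_measurable P" for k
        using that(2) U borel_measurable_continuous_onI[OF cont] measurable_cong_sets[OF that(2) refl]
        by auto
      have "(\<lambda>k. \<integral>x. \<phi> k x \<partial>P) \<longlonglongrightarrow> (\<integral>x. indicator U x \<partial>P)"
        by (rule integral_dominated_convergence[where w = "\<lambda>_. 1"]) (use lim bd in auto)
      then show ?thesis by simp
    qed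
    have "measure N U = measure N' U"
      using LIMSEQ_unique[OF *[OF assms(1,3)]] *[OF assms(2,4)] eq[OF cont] by simp
    then show ?thesis by (simp add: N.emeasure_eq_measure N'.emeasure_eq_measure)
  qed
qed (use assms(1) in \<open>auto simp: prob_space.finite_measure finite_measure.emeasure_finite\<close>)

section \<open>The metric on sequences\<close>

lemma compact_UNIV_sequences:
  assumes "compact (UNIV :: 'a::metric_space set)"
  shows "compact (UNIV :: (nat \<Rightarrow> 'a) set)"
proof -
  have "compact_space (product_topology (\<lambda>i::nat. euclidean :: 'a topology) UNIV)"
    using assms compact_space_product_topology[of "\<lambda>i::nat. euclidean :: 'a topology" UNIV]
    by (simp add: compact_space_def[of "euclidean :: 'a topology"])
  then show ?thesis
    by (simp add: euclidean_product_topology compact_space_def)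
qed

text \<open>The metric of the function type sums over coordinates enumerated by
  \<open>from_nat\<close>; \<open>p\<close> has to lie above all of the first \<open>N + 1\<close>
  enumerated indices.\<close>

lemma sequences_close_if_coordinates_close:
  assumes "0 < (d::real)"
  shows "\<exists>p::nat. \<exists>\<delta>::real. 0 < \<delta> \<and>
    (\<forall>x y :: nat \<Rightarrow> 'a::metric_space. (\<forall>i<p. dist (x i) (y i) < \<delta>) \<longrightarrow> dist x y < d)"
proof -
  obtain N where N: "(1/2::real)^N < d / 2"
    using assms real_arch_pow_inv[of "d/2" "1/2"] by auto
  define p where "p = Suc (Max ((from_nat :: nat \<Rightarrow> nat) ` {..N}))"
  have p: "from_nat n < p" if "n \<le> N" for n :: nat
    using that by (auto simp: p_def less_Suc_eq_le intro!: Max_ge)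
  show ?thesis
  proof (intro exI conjI allI impI)
    show "0 < d/4" using assms by simp
    fix x y :: "nat \<Rightarrow> 'a"
    assume close: "\<forall>i<p. dist (x i) (y i) < d/4"
    have fin: "finite {dist (x (from_nat n)) (y (from_nat n)) |n. n \<le> N}" by simp
    have "Max {dist (x (from_nat n)) (y (from_nat n)) |n. n \<le> N} \<le> d/4"
      using close p by (subst Max_le_iff[OF fin]) (auto intro: less_imp_le)
    then show "dist x y < d"
      using dist_fun_le_dist_first_terms[of x y N] N by linarith
  qed
qed

lemma coordinates_close_if_sequences_close:
  assumes "compact (UNIV :: 'a::metric_space set)" "0 < (\<delta>::real)"
  shows "\<exists>d>0. \<forall>x y :: nat \<Rightarrow> 'a. dist x y < d \<longrightarrow> (\<forall>i<p. dist (x i) (y i) < \<delta>)"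
proof (induction p)
  case (Suc p)
  then obtain d where d: "d > 0" "\<And>x y :: nat \<Rightarrow> 'a. dist x y < d \<Longrightarrow> \<forall>i<p. dist (x i) (y i) < \<delta>"
    by blast
  have "uniformly_continuous_on UNIV (\<lambda>x :: nat \<Rightarrow> 'a. x p)"
    by (intro compact_uniformly_continuous compact_UNIV_sequences assms) simp
  then obtain d' where d': "d' > 0" "\<And>x y :: nat \<Rightarrow> 'a. dist x y < d' \<Longrightarrow> dist (x p) (y p) < \<delta>"
    using assms(2) unfolding uniformly_continuous_on_def by (metis UNIV_I dist_commute)
  show ?case
    using d d' by (intro exI[of _ "min d d'"]) (auto simp: less_Suc_eq)
qed (auto intro: exI[of _ 1])

text \<open>Prepended coordinates agree exactly, and the later ones are coordinates of
  \<open>x\<close> and \<open>y\<close> with no larger index. Hence \<open>d'\<close> depends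
  neither on \<open>n\<close> nor on \<open>a\<close>, which keeps
  \<open>ratio_equicontinuous\<close> uniform in \<open>n\<close>.\<close>

lemma prepend_close:
  assumes "compact (UNIV :: 'a::metric_space set)" "0 < (d::real)"
  obtains d' where "0 < d'"
    "\<forall>(x :: nat \<Rightarrow> 'a) y n a. dist x y < d' \<longrightarrow> dist (prepend n a x) (prepend n a y) < d"
proof -
  obtain p \<delta> where \<delta>: "0 < \<delta>"
    "\<forall>x y :: nat \<Rightarrow> 'a. (\<forall>i<p. dist (x i) (y i) < \<delta>) \<longrightarrow> dist x y < d"
    using sequences_close_if_coordinates_close[OF assms(2)] by blast
  obtain d' where d': "0 < d'" "\<forall>x y :: nat \<Rightarrow> 'a. dist x y < d' \<longrightarrow> (\<forall>i<p. dist (x i) (y i) < \<delta>)"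
    using coordinates_close_if_sequences_close[OF assms(1) \<delta>(1)] by blast
  show thesis
  proof (rule that[OF d'(1)], intro allI impI)
    fix x y a :: "nat \<Rightarrow> 'a" and n assume "dist x y < d'"
    then show "dist (prepend n a x) (prepend n a y) < d"
      using d'(2) \<delta>(1) by (intro \<delta>(2)[rule_format]) (auto simp: prepend_def)
  qed
qed

lemma summable_dOmega:
  assumes "compact (UNIV :: 'a::metric_space set)"
  shows "summable (\<lambda>n. (1/2)^(Suc n) * dist (x n) (y n :: 'a))"
proof -
  obtain D where D: "\<And>u v :: 'a. dist u v \<le> D"
    using compact_imp_bounded[OF assms] by (auto simp: bounded_two_points)
  have "norm (c * dist u v) \<le> c * D" if "0 \<le> c" for c and u v :: 'a
    using that D by (simp add: abs_mult mult_left_mono)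
  then show ?thesis
    by (intro summable_comparison_test'[OF sums_summable[OF sums_mult2[OF power_half_series, of D]], of 0])
      simp
qed

lemma dist_coordinate_le_dOmega:
  assumes "compact (UNIV :: 'a::metric_space set)"
  shows "(1/2)^(Suc n) * dist (x n) (y n :: 'a) \<le> dOmega x y"
  unfolding dOmega_def
  using sum_le_suminf[OF summable_dOmega[OF assms, of x y], of "{n}"] by simp

lemma continuous_on_dOmega:
  assumes "compact (UNIV :: 'a::metric_space set)"
  shows "continuous_on UNIV (\<lambda>p :: (nat \<Rightarrow> 'a) \<times> (nat \<Rightarrow> 'a). dOmega (fst p) (snd p))"
proof -
  obtain D where D: "\<And>u v :: 'a. dist u v \<le> D"
    using compact_imp_bounded[OF assms] by (auto simp: bounded_two_points)
  have "uniform_limit UNIV (\<lambda>N (p :: (nat \<Rightarrow> 'a) \<times> (nat \<Rightarrow> 'a)). \<Sum>n<N. (1/2)^(Suc n) * dist (fst p n) (snd p n))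
      (\<lambda>p. \<Sum>n. (1/2)^(Suc n) * dist (fst p n) (snd p n)) sequentially"
  proof (rule Weierstrass_m_test[where M = "\<lambda>n. (1/2)^(Suc n) * D"])
    show "norm ((1/2)^(Suc n) * dist (fst p n) (snd p n)) \<le> (1/2)^(Suc n) * D"
      for n and p :: "(nat \<Rightarrow> 'a) \<times> (nat \<Rightarrow> 'a)"
      using D by (simp add: abs_mult)
    show "summable (\<lambda>n. (1/2)^(Suc n) * D)"
      by (rule sums_summable[OF sums_mult2[OF power_half_series, of D]])
  qed
  moreover have "continuous_on UNIV (\<lambda>p :: (nat \<Rightarrow> 'a) \<times> (nat \<Rightarrow> 'a). \<Sum>n<N. (1/2)^(Suc n) * dist (fst p n) (snd p n))" for N
    by (intro continuous_intros continuous_on_product_then_coordinatewise)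
  ultimately show ?thesis
    unfolding dOmega_def by (intro uniform_limit_theorem[where F = sequentially]) auto
qed

lemma dOmega_less_if_dist_less:
  assumes "compact (UNIV :: 'a::metric_space set)" "0 < e"
  obtains d where "0 < d" "\<forall>x y :: nat \<Rightarrow> 'a. dist x y < d \<longrightarrow> dOmega x y < e"
proof -
  have "compact (UNIV :: ((nat \<Rightarrow> 'a) \<times> (nat \<Rightarrow> 'a)) set)"
    using compact_Times[OF compact_UNIV_sequences compact_UNIV_sequences, OF assms(1) assms(1)] by simp
  then have "uniformly_continuous_on UNIV (\<lambda>p :: (nat \<Rightarrow> 'a) \<times> (nat \<Rightarrow> 'a). dOmega (fst p) (snd p))"
    by (intro compact_uniformly_continuous continuous_on_dOmega assms)
  then obtain d where d: "0 < d" "\<And>p q :: (nat \<Rightarrow> 'a) \<times> (nat \<Rightarrow> 'a). dist p q < d \<Longrightarrow>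
      dist (dOmega (fst p) (snd p)) (dOmega (fst q) (snd q)) < e"
    using assms(2) unfolding uniformly_continuous_on_def by (metis UNIV_I dist_commute)
  show thesis
  proof (rule that[OF d(1)], intro allI impI)
    fix x y :: "nat \<Rightarrow> 'a" assume "dist x y < d"
    then have "dist (x, y) (x, x) < d" by (simp add: dist_Pair_Pair dist_commute)
    from d(2)[OF this] show "dOmega x y < e"
      by (simp add: dOmega_def dist_real_def)
  qed
qed

lemma dist_less_if_dOmega_less:
  assumes "compact (UNIV :: 'a::metric_space set)" "0 < (d::real)"
  obtains e where "0 < e" "\<forall>x y :: nat \<Rightarrow> 'a. dOmega x y < e \<longrightarrow> dist x y < d"
proof -
  obtain p \<delta> where \<delta>: "0 < \<delta>"
    "\<forall>x y :: nat \<Rightarrow> 'a. (\<forall>i<p. dist (x i) (y i) < \<delta>) \<longrightarrow> dist x y < d"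
    using sequences_close_if_coordinates_close[OF assms(2)] by blast
  show thesis
  proof (rule that)
    \<comment> \<open>\<open>(1/2)^p\<close> is the smallest weight that \<open>dOmega\<close> gives
      to one of the first \<open>p\<close> coordinates.\<close>
    show "0 < (1/2)^p * \<delta>" using \<delta> by simp
    show "\<forall>x y :: nat \<Rightarrow> 'a. dOmega x y < (1/2)^p * \<delta> \<longrightarrow> dist x y < d"
    proof (intro allI impI)
      fix x y :: "nat \<Rightarrow> 'a" assume less: "dOmega x y < (1/2)^p * \<delta>"
      show "dist x y < d"
      proof (rule \<delta>(2)[rule_format])
        fix i assume "i < p"
        then have "(1/2)^p * dist (x i) (y i) \<le> (1/2)^(Suc i) * dist (x i) (y i)"
          by (intro mult_right_mono power_decreasing) auto
        also have "\<dots> < (1/2)^p * \<delta>"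
          using dist_coordinate_le_dOmega[OF assms(1), of i x y] less by linarith
        finally show "dist (x i) (y i) < \<delta>"
          using mult_less_cancel_left_pos[of "(1/2)^p" "dist (x i) (y i)" \<delta>] by simp
      qed
    qed
  qed
qed

section \<open>Passage from \<open>dOmega\<close> to the product topology\<close>

lemma cont_Omega_iff:
  assumes "compact (UNIV :: 'a::metric_space set)"
  shows "cont_Omega (g :: (nat \<Rightarrow> 'a) \<Rightarrow> real) \<longleftrightarrow> continuous_on UNIV g"
proof
  assume g: "cont_Omega g"
  show "continuous_on UNIV g"
    unfolding continuous_on_iff
  proof (intro ballI allI impI)
    fix x and e :: real assume "0 < e"
    with g obtain e' where e': "0 < e'" "\<And>y. dOmega x y < e' \<Longrightarrow> \<bar>g y - g x\<bar> < e"
      unfolding cont_Omega_def by metis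
    obtain d where d: "0 < d" "\<forall>x y :: nat \<Rightarrow> 'a. dist x y < d \<longrightarrow> dOmega x y < e'"
      using dOmega_less_if_dist_less[OF assms e'(1)] by blast
    show "\<exists>d>0. \<forall>y\<in>UNIV. dist y x < d \<longrightarrow> dist (g y) (g x) < e"
      using d e'(2) by (metis dist_commute dist_real_def)
  qed
next
  assume g: "continuous_on UNIV g"
  show "cont_Omega g"
    unfolding cont_Omega_def
  proof (intro allI impI)
    fix x and e :: real assume "0 < e"
    with g obtain d where d: "0 < d" "\<And>y. dist y x < d \<Longrightarrow> dist (g y) (g x) < e"
      unfolding continuous_on_iff by (metis UNIV_I)
    obtain e' where e': "0 < e'" "\<forall>x y :: nat \<Rightarrow> 'a. dOmega x y < e' \<longrightarrow> dist x y < d"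
      using dist_less_if_dOmega_less[OF assms d(1)] by blast
    show "\<exists>d>0. \<forall>y. dOmega x y < d \<longrightarrow> \<bar>g y - g x\<bar> < e"
      using d(2) e' by (metis dist_commute dist_real_def)
  qed
qed

lemma open_Omega_iff:
  assumes "compact (UNIV :: 'a::metric_space set)"
  shows "open_Omega (U :: (nat \<Rightarrow> 'a) set) \<longleftrightarrow> open U"
proof
  assume U: "open_Omega U"
  show "open U"
    unfolding open_dist
  proof
    fix x assume "x \<in> U"
    with U obtain e where e: "0 < e" "\<And>y. dOmega x y < e \<Longrightarrow> y \<in> U"
      unfolding open_Omega_def by metis
    obtain d where "0 < d" "\<forall>x y :: nat \<Rightarrow> 'a. dist x y < d \<longrightarrow> dOmega x y < e"
      using dOmega_less_if_dist_less[OF assms e(1)] by blast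
    then show "\<exists>d>0. \<forall>y. dist y x < d \<longrightarrow> y \<in> U"
      using e(2) by (metis dist_commute)
  qed
next
  assume U: "open U"
  show "open_Omega U"
    unfolding open_Omega_def
  proof
    fix x assume "x \<in> U"
    with U obtain d where d: "0 < d" "\<And>y. dist y x < d \<Longrightarrow> y \<in> U"
      unfolding open_dist by metis
    obtain e where "0 < e" "\<forall>x y :: nat \<Rightarrow> 'a. dOmega x y < e \<longrightarrow> dist x y < d"
      using dist_less_if_dOmega_less[OF assms d(1)] by blast
    then show "\<exists>e>0. \<forall>y. dOmega x y < e \<longrightarrow> y \<in> U"
      using d(2) by (metis dist_commute)
  qed
qed

lemma borel_Omega_eq_borel:
  assumes "compact (UNIV :: 'a::metric_space set)"
  shows "(borel_Omega :: (nat \<Rightarrow> 'a) measure) = borel"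
  unfolding borel_Omega_def borel_def open_Omega_iff[OF assms] ..

text \<open>The bound is one-sided because \<open>x\<close> and \<open>y\<close> may be exchanged.
  One \<open>d\<close> serves all lengths and all words; \<open>walters_C\<close> starts at length
  1, and length 0 is added, where both sums are empty.\<close>

lemma weak_walters_distortion:
  assumes "compact (UNIV :: 'a::metric_space set)" "weak_walters (f :: (nat \<Rightarrow> 'a) \<Rightarrow> real)" "0 < e"
  obtains d where "0 < d"
    "\<forall>x y n a. dist x y < d \<longrightarrow> birkhoff_sum f n (prepend n a x) - birkhoff_sum f n (prepend n a y) \<le> e"
proof -
  obtain e' where e': "0 < e'" "\<And>x y. dOmega x y < e' \<Longrightarrow> \<bar>walters_C f x y\<bar> < ereal e"
    using assms(2,3) unfolding weak_walters_def by metis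
  obtain d where d: "0 < d" "\<forall>x y :: nat \<Rightarrow> 'a. dist x y < d \<longrightarrow> dOmega x y < e'"
    using dOmega_less_if_dist_less[OF assms(1) e'(1)] by blast
  show thesis
  proof (rule that[OF d(1)], intro allI impI)
    fix x y a :: "nat \<Rightarrow> 'a" and n assume "dist x y < d"
    then have "\<bar>walters_C f x y\<bar> < ereal e"
      using e'(2) d(2) by blast
    then have C: "walters_C f x y \<le> ereal e"
      by (cases "walters_C f x y") auto
    show "birkhoff_sum f n (prepend n a x) - birkhoff_sum f n (prepend n a y) \<le> e"
    proof (cases "n = 0")
      case False
      then have "(n, a) \<in> {(n, a). 1 \<le> n}" by simp
      from SUP_upper[OF this, of "\<lambda>na. ereal (birkhoff_sum f (fst na) (prepend (fst na) (snd na) x)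
           - birkhoff_sum f (fst na) (prepend (fst na) (snd na) y))"]
      have "ereal (birkhoff_sum f n (prepend n a x) - birkhoff_sum f n (prepend n a y)) \<le> walters_C f x y"
        unfolding walters_C_def by simp
      then show ?thesis using C by (metis ereal_less_eq(3) order_trans)
    qed (use assms(3) in \<open>simp add: birkhoff_sum_def\<close>)
  qed
qed

section \<open>Words in front of a sequence and their Birkhoff sums\<close>

lemma prepend_0 [simp]: "prepend 0 a x = x"
  by (simp add: prepend_def)

text \<open>In \<open>L ^^ Suc n\<close> the outermost integration is over the symbol next to
  \<open>x\<close>, which sits at index \<open>n\<close> of the word. With
  \<open>birkhoff_sum_Suc_prepend\<close> this splits the weight of a word of length
  \<open>n + 1\<close> into the weight of its first \<open>n\<close> symbols, placed in front of
  \<open>cons_seq a x\<close>, and the factor \<open>exp (f (cons_seq a x))\<close>.\<close>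

lemma prepend_Suc: "prepend (Suc n) (b(n := a)) x = prepend n b (cons_seq a x)"
proof
  fix k
  consider "k < n" | "k = n" | m where "k = Suc (n + m)"
    using less_imp_Suc_add by (metis linorder_neqE_nat)
  then show "prepend (Suc n) (b(n := a)) x k = prepend n b (cons_seq a x) k"
    by cases (auto simp: prepend_def cons_seq_def Suc_diff_le)
qed

lemma cons_seq_eq_prepend: "cons_seq a x = prepend 1 (\<lambda>_. a) x"
  by (auto simp: prepend_def cons_seq_def fun_eq_iff split: nat.split)

lemma shift_funpow: "(shift ^^ n) x = (\<lambda>k. x (n + k))"
  by (induction n) (auto simp: shift_def fun_eq_iff)

lemma birkhoff_sum_Suc_prepend:
  "birkhoff_sum f (Suc n) (prepend n b y) = birkhoff_sum f n (prepend n b y) + f y"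
  by (simp add: birkhoff_sum_def shift_funpow prepend_def)

lemma continuous_on_cons_seq: "continuous_on UNIV (\<lambda>a::'a::topological_space. cons_seq a x)"
proof (rule continuous_on_coordinatewise_then_product)
  show "continuous_on UNIV (\<lambda>a. cons_seq a x i)" for i
    by (cases i) (simp_all add: cons_seq_def)
qed

section \<open>The Ruelle operator\<close>

locale ruelle_operator =
  fixes \<mu> :: "'a::metric_space measure" and f :: "(nat \<Rightarrow> 'a) \<Rightarrow> real"
  assumes compact_alphabet: "compact (UNIV :: 'a set)"
    and prob: "prob_space \<mu>" and sets_\<mu>: "sets \<mu> = sets borel"
    and support: "full_support \<mu>"
    and f_cont: "continuous_on UNIV f" and walters: "weak_walters f"
begin

sublocale prob_space \<mu> by (rule prob)

abbreviation "L \<equiv> ruelle \<mu> f"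

abbreviation ratio :: "nat \<Rightarrow> ((nat \<Rightarrow> 'a) \<Rightarrow> real) \<Rightarrow> (nat \<Rightarrow> 'a) \<Rightarrow> real" where
  "ratio n \<phi> x \<equiv> (L ^^ n) \<phi> x / (L ^^ n) (\<lambda>_. 1) x"

lemma compact_sequences: "compact (UNIV :: (nat \<Rightarrow> 'a) set)"
  by (rule compact_UNIV_sequences[OF compact_alphabet])

lemma integrable_branch:
  fixes g :: "(nat \<Rightarrow> 'a) \<Rightarrow> real"
  assumes "continuous_on UNIV g"
  shows "integrable \<mu> (\<lambda>a. g (cons_seq a x))"
proof (rule integrable_continuous_compact_UNIV[OF compact_alphabet _ finite_measure_axioms sets_\<mu>])
  show "continuous_on UNIV (\<lambda>a. g (cons_seq a x))"
    using continuous_on_compose[OF continuous_on_cons_seq continuous_on_subset[OF assms]] by (simp add: o_def)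
qed

lemma integrable_ruelle:
  assumes "continuous_on UNIV \<phi>"
  shows "integrable \<mu> (\<lambda>a. exp (f (cons_seq a x)) * \<phi> (cons_seq a x))"
  using integrable_branch[of "\<lambda>u. exp (f u) * \<phi> u" x] assms f_cont by (simp add: continuous_intros)

lemma ruelle_cont:
  assumes "continuous_on UNIV \<phi>"
  shows "continuous_on UNIV (L \<phi>)"
  unfolding continuous_on_iff
proof (intro ballI allI impI)
  fix x and e :: real assume e: "0 < e"
  have "uniformly_continuous_on UNIV (\<lambda>u. exp (f u) * \<phi> u)"
    using assms f_cont by (intro compact_uniformly_continuous compact_sequences continuous_intros)
  then obtain d where d: "0 < d" "\<forall>u v. dist v u < d \<longrightarrow> dist (exp (f v) * \<phi> v) (exp (f u) * \<phi> u) < e / 2"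
    using e unfolding uniformly_continuous_on_def by (metis UNIV_I half_gt_zero)
  obtain d' where d': "0 < d'"
    "\<forall>(x :: nat \<Rightarrow> 'a) y n a. dist x y < d' \<longrightarrow> dist (prepend n a x) (prepend n a y) < d"
    by (rule prepend_close[OF compact_alphabet d(1)])
  have "dist (L \<phi> y) (L \<phi> x) < e" if "dist y x < d'" for y
  proof -
    have "\<bar>L \<phi> y - L \<phi> x\<bar> = \<bar>\<integral>a. exp (f (cons_seq a y)) * \<phi> (cons_seq a y) - exp (f (cons_seq a x)) * \<phi> (cons_seq a x) \<partial>\<mu>\<bar>"
      unfolding ruelle_def by (simp add: Bochner_Integration.integral_diff integrable_ruelle assms)
    also have "\<dots> \<le> (\<integral>a. \<bar>exp (f (cons_seq a y)) * \<phi> (cons_seq a y) - exp (f (cons_seq a x)) * \<phi> (cons_seq a x)\<bar> \<partial>\<mu>)"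
      by (rule integral_abs_bound)
    also have "\<dots> \<le> (\<integral>a. e / 2 \<partial>\<mu>)"
    proof (rule integral_mono)
      fix a
      have "dist (cons_seq a y) (cons_seq a x) < d"
        unfolding cons_seq_eq_prepend using d'(2) that by blast
      then show "\<bar>exp (f (cons_seq a y)) * \<phi> (cons_seq a y) - exp (f (cons_seq a x)) * \<phi> (cons_seq a x)\<bar> \<le> e / 2"
        using d(2) unfolding dist_real_def by (meson less_imp_le)
    qed (auto intro!: integrable_abs Bochner_Integration.integrable_diff integrable_ruelle assms)
    also have "\<dots> = e / 2" using prob_space by simp
    finally show ?thesis using e by (simp add: dist_real_def)
  qed
  then show "\<exists>d>0. \<forall>y\<in>UNIV. dist y x < d \<longrightarrow> dist (L \<phi> y) (L \<phi> x) < e"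
    using d'(1) by blast
qed

lemma iterate_cont:
  assumes "continuous_on UNIV \<phi>"
  shows "continuous_on UNIV ((L ^^ n) \<phi>)"
  using assms by (induction n) (simp_all add: ruelle_cont)

lemma ruelle_add:
  assumes "continuous_on UNIV \<phi>" "continuous_on UNIV \<psi>"
  shows "L (\<lambda>x. \<phi> x + \<psi> x) = (\<lambda>x. L \<phi> x + L \<psi> x)"
  by (simp add: ruelle_def fun_eq_iff distrib_left integrable_ruelle assms)

lemma ruelle_scale: "L (\<lambda>x. c * \<phi> x) = (\<lambda>x. c * L \<phi> x)"
  by (simp add: ruelle_def fun_eq_iff mult.left_commute[of _ c])

lemma iterate_add:
  assumes "continuous_on UNIV \<phi>" "continuous_on UNIV \<psi>"
  shows "(L ^^ n) (\<lambda>x. \<phi> x + \<psi> x) = (\<lambda>x. (L ^^ n) \<phi> x + (L ^^ n) \<psi> x)"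
  by (induction n) (simp_all add: ruelle_add iterate_cont assms)

lemma iterate_scale: "(L ^^ n) (\<lambda>x. c * \<phi> x) = (\<lambda>x. c * (L ^^ n) \<phi> x)"
  by (induction n) (simp_all add: ruelle_scale)

lemma iterate_add_apply: "(L ^^ (m + n)) \<phi> = (L ^^ n) ((L ^^ m) \<phi>)"
  by (subst add.commute) (simp add: funpow_add)

lemma iterate_Suc_apply: "(L ^^ Suc n) \<phi> = (L ^^ n) (L \<phi>)"
  by (simp add: funpow_swap1)

text \<open>Takes the place of writing \<open>L ^^ n\<close> as an integral over all words of length
  \<open>n\<close>: an inequality between integrands, word by word, passes to the iterates. The
  points and the functions on the two sides may differ, as distortion estimates require.\<close>

lemma iterate_compare:
  assumes "continuous_on UNIV \<phi>" "continuous_on UNIV \<psi>"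
    and "\<And>a. exp (birkhoff_sum f n (prepend n a x)) * \<phi> (prepend n a x)
      \<le> K * (exp (birkhoff_sum f n (prepend n a y)) * \<psi> (prepend n a y))"
  shows "(L ^^ n) \<phi> x \<le> K * (L ^^ n) \<psi> y"
  using assms(3)
proof (induction n arbitrary: K x y)
  case 0
  then show ?case by (simp add: birkhoff_sum_def)
next
  case (Suc n)
  have step: "exp (f (cons_seq a x)) * (L ^^ n) \<phi> (cons_seq a x)
    \<le> K * (exp (f (cons_seq a y)) * (L ^^ n) \<psi> (cons_seq a y))" for a
  proof -
    \<comment> \<open>The weights of the symbol \<open>a\<close> are moved into the constant; this
      is why \<open>K\<close> varies in the induction.\<close>
    let ?K = "K * exp (f (cons_seq a y)) / exp (f (cons_seq a x))"
    have "(L ^^ n) \<phi> (cons_seq a x) \<le> ?K * (L ^^ n) \<psi> (cons_seq a y)"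
    proof (rule Suc.IH)
      fix b
      show "exp (birkhoff_sum f n (prepend n b (cons_seq a x))) * \<phi> (prepend n b (cons_seq a x))
        \<le> ?K * (exp (birkhoff_sum f n (prepend n b (cons_seq a y))) * \<psi> (prepend n b (cons_seq a y)))"
        using Suc.prems[of "b(n := a)"]
        unfolding prepend_Suc birkhoff_sum_Suc_prepend exp_add
        by (simp add: field_simps)
    qed
    then show ?thesis by (simp add: field_simps)
  qed
  have "L ((L ^^ n) \<phi>) x \<le> (\<integral>a. K * (exp (f (cons_seq a y)) * (L ^^ n) \<psi> (cons_seq a y)) \<partial>\<mu>)"
    unfolding ruelle_def[of \<mu> f "(L ^^ n) \<phi>"]
    by (intro integral_mono step integrable_mult_right integrable_ruelle iterate_cont assms)
  then show ?case by (simp add: ruelle_def[of \<mu> f "(L ^^ n) \<psi>"])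
qed

lemma iterate_mono:
  assumes "continuous_on UNIV \<phi>" "continuous_on UNIV \<psi>" "\<And>x. \<phi> x \<le> \<psi> x"
  shows "(L ^^ n) \<phi> x \<le> (L ^^ n) \<psi> x"
  using iterate_compare[OF assms(1,2), of n x 1 x] assms(3) by simp

section \<open>Uniform estimates for the iterates of the constant 1\<close>

lemma potential_bounded:
  obtains F where "0 \<le> F" "\<forall>x. \<bar>f x\<bar> \<le> F"
proof -
  obtain F where "\<forall>x. \<bar>f x\<bar> \<le> F"
    by (rule continuous_on_compact_UNIV_bounded[OF compact_sequences f_cont])
  then show thesis using that by (meson abs_ge_zero order_trans)
qed

lemma birkhoff_sum_bounded:
  assumes "\<forall>x. \<bar>f x\<bar> \<le> F"
  shows "\<bar>birkhoff_sum f n x\<bar> \<le> real n * F"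
proof -
  have "\<bar>birkhoff_sum f n x\<bar> \<le> (\<Sum>i<n. \<bar>f ((shift ^^ i) x)\<bar>)"
    unfolding birkhoff_sum_def by (rule sum_abs)
  also have "\<dots> \<le> (\<Sum>i<n. F)" using assms by (intro sum_mono) blast
  finally show ?thesis by simp
qed

lemma iterate_one_bounds:
  assumes F: "\<forall>x. \<bar>f x\<bar> \<le> F"
  shows "exp (- (real n * F)) \<le> (L ^^ n) (\<lambda>_. 1) x" "(L ^^ n) (\<lambda>_. 1) x \<le> exp (real n * F)"
proof -
  have const: "L (\<lambda>_. 1) x \<le> exp F \<and> exp (- F) \<le> L (\<lambda>_. 1) x" for x
  proof -
    have i: "integrable \<mu> (\<lambda>a. exp (f (cons_seq a x)))"
      using integrable_ruelle[of "\<lambda>_. 1" x] by simp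
    have "f (cons_seq a x) \<le> F" "- F \<le> f (cons_seq a x)" for a
      using spec[OF F, of "cons_seq a x"] by auto
    then have "(\<integral>a. exp (f (cons_seq a x)) \<partial>\<mu>) \<le> (\<integral>a. exp F \<partial>\<mu>)"
      "(\<integral>a. exp (- F) \<partial>\<mu>) \<le> (\<integral>a. exp (f (cons_seq a x)) \<partial>\<mu>)"
      by (intro integral_mono i; simp)+
    then show ?thesis using prob_space by (simp add: ruelle_def)
  qed
  have 1: "continuous_on UNIV (\<lambda>_ :: nat \<Rightarrow> 'a. 1 :: real)" by simp
  have "exp (- (real n * F)) \<le> (L ^^ n) (\<lambda>_. 1) x \<and> (L ^^ n) (\<lambda>_. 1) x \<le> exp (real n * F)"
  proof (induction n)
    case (Suc n)
    have "exp (- F) * (L ^^ n) (\<lambda>_. 1) x \<le> (L ^^ Suc n) (\<lambda>_. 1) x"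
      using iterate_mono[of "\<lambda>_. exp (- F) * 1" "L (\<lambda>_. 1)" n x] const ruelle_cont[OF 1]
      unfolding iterate_Suc_apply iterate_scale by simp
    moreover have "(L ^^ Suc n) (\<lambda>_. 1) x \<le> exp F * (L ^^ n) (\<lambda>_. 1) x"
      using iterate_mono[of "L (\<lambda>_. 1)" "\<lambda>_. exp F * 1" n x] const ruelle_cont[OF 1]
      unfolding iterate_Suc_apply iterate_scale by simp
    moreover have "exp (- F) * exp (- (real n * F)) \<le> exp (- F) * (L ^^ n) (\<lambda>_. 1) x"
      "exp F * (L ^^ n) (\<lambda>_. 1) x \<le> exp F * exp (real n * F)"
      using Suc by (auto intro!: mult_left_mono)
    moreover have "exp (- (real (Suc n) * F)) = exp (- F) * exp (- (real n * F))"
      "exp (real (Suc n) * F) = exp F * exp (real n * F)"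
      by (simp_all add: distrib_right flip: exp_add)
    ultimately show ?case by linarith
  qed simp
  then show "exp (- (real n * F)) \<le> (L ^^ n) (\<lambda>_. 1) x" "(L ^^ n) (\<lambda>_. 1) x \<le> exp (real n * F)"
    by auto
qed

lemma iterate_one_pos: "0 < (L ^^ n) (\<lambda>_. 1) x"
proof -
  obtain F where "\<forall>x. \<bar>f x\<bar> \<le> F" by (rule potential_bounded)
  from iterate_one_bounds(1)[OF this, of n x] show ?thesis
    by (meson exp_gt_zero less_le_trans)
qed

text \<open>By the weak Walters condition the weights of each word at \<open>x\<close> and at
  \<open>y\<close> differ by a factor of at most \<open>exp e\<close>; hence the logarithms of all
  \<open>L ^^ n 1\<close> share one modulus of continuity.\<close>

lemma iterate_one_near:
  assumes "0 < e"
  obtains d where "0 < d"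
    "\<forall>x y n. dist x y < d \<longrightarrow> (L ^^ n) (\<lambda>_. 1) x \<le> exp e * (L ^^ n) (\<lambda>_. 1) y"
proof -
  obtain d where d: "0 < d"
    "\<forall>x y n a. dist x y < d \<longrightarrow> birkhoff_sum f n (prepend n a x) - birkhoff_sum f n (prepend n a y) \<le> e"
    by (rule weak_walters_distortion[OF compact_alphabet walters assms])
  show thesis
  proof (rule that[OF d(1)], intro allI impI)
    fix x y :: "nat \<Rightarrow> 'a" and n assume xy: "dist x y < d"
    show "(L ^^ n) (\<lambda>_. 1) x \<le> exp e * (L ^^ n) (\<lambda>_. 1) y"
    proof (rule iterate_compare)
      fix a
      have "birkhoff_sum f n (prepend n a x) \<le> e + birkhoff_sum f n (prepend n a y)"
        using d(2) xy by (metis diff_le_eq)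
      then show "exp (birkhoff_sum f n (prepend n a x)) * 1 \<le> exp e * (exp (birkhoff_sum f n (prepend n a y)) * 1)"
        by (simp flip: exp_add)
    qed auto
  qed
qed

text \<open>With the same \<open>p\<close> symbols in front, any two points are closer than
  \<open>d\<close>. So \<open>L ^^ m 1\<close> is compared at such close points with a factor
  \<open>exp 1\<close>, and the remaining \<open>p\<close> iterations cost at most
  \<open>exp (2 * (real p * F))\<close>; fewer than \<open>p\<close> iterations are covered by the
  crude bounds.\<close>

lemma iterate_one_harnack:
  obtains K where "1 \<le> K" "\<forall>n x y. (L ^^ n) (\<lambda>_. 1) x \<le> K * (L ^^ n) (\<lambda>_. 1) y"
proof -
  obtain F where F: "0 \<le> F" "\<forall>x. \<bar>f x\<bar> \<le> F" by (rule potential_bounded)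
  obtain d where d: "0 < d"
    "\<forall>x y n. dist x y < d \<longrightarrow> (L ^^ n) (\<lambda>_. 1) x \<le> exp 1 * (L ^^ n) (\<lambda>_. 1) y"
    by (rule iterate_one_near[of 1]) auto
  obtain p \<delta> where \<delta>: "0 < \<delta>"
    "\<forall>x y :: nat \<Rightarrow> 'a. (\<forall>i<p. dist (x i) (y i) < \<delta>) \<longrightarrow> dist x y < d"
    using sequences_close_if_coordinates_close[OF d(1)] by blast
  define K where "K = exp (1 + 2 * (real p * F))"
  show thesis
  proof (rule that)
    show "1 \<le> K" using F(1) by (simp add: K_def)
    show "\<forall>n x y. (L ^^ n) (\<lambda>_. 1) x \<le> K * (L ^^ n) (\<lambda>_. 1) y"
    proof (intro allI)
      fix n and x y :: "nat \<Rightarrow> 'a"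
      show "(L ^^ n) (\<lambda>_. 1) x \<le> K * (L ^^ n) (\<lambda>_. 1) y"
      proof (cases "n < p")
        case True
        have "(L ^^ n) (\<lambda>_. 1) x \<le> exp (real n * F)" by (rule iterate_one_bounds(2)[OF F(2)])
        also have "\<dots> \<le> K * exp (- (real n * F))"
        proof -
          have "real n * F \<le> real p * F" using True F(1) by (intro mult_right_mono) auto
          then show ?thesis by (simp add: K_def mult.commute[of F] flip: exp_add)
        qed
        also have "\<dots> \<le> K * (L ^^ n) (\<lambda>_. 1) y"
          by (intro mult_left_mono iterate_one_bounds(1)[OF F(2)]) (simp add: K_def)
        finally show ?thesis .
      next
        case False
        then obtain m where n: "n = m + p" by (metis add.commute le_Suc_ex not_less)
        have "(L ^^ p) ((L ^^ m) (\<lambda>_. 1)) x \<le> K * (L ^^ p) ((L ^^ m) (\<lambda>_. 1)) y"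
        proof (intro iterate_compare iterate_cont)
          fix a
          have "dist (prepend p a x) (prepend p a y) < d"
            using \<delta> by (auto simp: prepend_def)
          then have 1: "(L ^^ m) (\<lambda>_. 1) (prepend p a x) \<le> exp 1 * (L ^^ m) (\<lambda>_. 1) (prepend p a y)"
            using d(2) by blast
          have "birkhoff_sum f p (prepend p a x) \<le> 2 * (real p * F) + birkhoff_sum f p (prepend p a y)"
            using birkhoff_sum_bounded[OF F(2), of p "prepend p a x"]
              birkhoff_sum_bounded[OF F(2), of p "prepend p a y"] by linarith
          then have 2: "exp (birkhoff_sum f p (prepend p a x)) \<le> exp (2 * (real p * F)) * exp (birkhoff_sum f p (prepend p a y))"
            by (simp flip: exp_add)
          have "exp (birkhoff_sum f p (prepend p a x)) * (L ^^ m) (\<lambda>_. 1) (prepend p a x)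
            \<le> (exp (2 * (real p * F)) * exp (birkhoff_sum f p (prepend p a y))) * (exp 1 * (L ^^ m) (\<lambda>_. 1) (prepend p a y))"
            using iterate_one_pos by (intro mult_mono 1 2) (auto intro: less_imp_le)
          then show "exp (birkhoff_sum f p (prepend p a x)) * (L ^^ m) (\<lambda>_. 1) (prepend p a x)
            \<le> K * (exp (birkhoff_sum f p (prepend p a y)) * (L ^^ m) (\<lambda>_. 1) (prepend p a y))"
            by (simp add: K_def exp_add mult_ac)
        qed auto
        then show ?thesis unfolding n iterate_add_apply .
      qed
    qed
  qed
qed

section \<open>Full support and the decay of oscillation\<close>

lemma measure_ball_bounded_below:
  assumes "0 < \<delta>"
  obtains b where "0 < b" "\<forall>z. b \<le> measure \<mu> (ball z \<delta>)"
proof -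
  \<comment> \<open>Every ball of radius \<open>\<delta>\<close> contains one of these finitely many
    balls of half the radius.\<close>
  obtain T :: "'a set" where T: "T \<subseteq> UNIV" "finite T" "UNIV \<subseteq> (\<Union>z\<in>T. ball z (\<delta>/2))"
    by (rule compactE_image[OF compact_alphabet, of UNIV "\<lambda>z. ball z (\<delta>/2)"]) (use assms in auto)
  define b where "b = Min ((\<lambda>z. measure \<mu> (ball z (\<delta>/2))) ` T)"
  have "T \<noteq> {}" using T(3) by auto
  have meas: "ball z r \<in> sets \<mu>" for z r by (simp add: sets_\<mu>)
  have pos: "0 < measure \<mu> (ball z (\<delta>/2))" for z
    using support assms unfolding full_support_def by (simp add: emeasure_eq_measure)
  show thesis
  proof (rule that)
    show "0 < b" unfolding b_def using T(2) \<open>T \<noteq> {}\<close> pos by simp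
    show "\<forall>z. b \<le> measure \<mu> (ball z \<delta>)"
    proof
      fix z
      obtain c where c: "c \<in> T" "z \<in> ball c (\<delta>/2)" using T(3) by blast
      have "b \<le> measure \<mu> (ball c (\<delta>/2))" unfolding b_def using T(2) c(1) by simp
      also have "\<dots> \<le> measure \<mu> (ball z \<delta>)"
      proof (rule finite_measure_mono[OF _ meas], rule subsetI)
        fix w assume "w \<in> ball c (\<delta>/2)"
        then show "w \<in> ball z \<delta>"
          using c(2) dist_triangle[of z w c] by (simp add: dist_commute)
      qed
      finally show "b \<le> measure \<mu> (ball z \<delta>)" .
    qed
  qed
qed

text \<open>Quantitative density of preimages: the integral is restricted to words whose symbols
  follow \<open>z\<close> to within \<open>\<delta>\<close>. Each symbol contributes mass at least
  \<open>b\<close> and weight at least \<open>exp (- F)\<close>.\<close>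

lemma iterate_lower_bound:
  assumes F: "\<forall>x. \<bar>f x\<bar> \<le> F" and b: "0 < b" "\<forall>z. b \<le> measure \<mu> (ball z \<delta>)"
    and \<psi>: "continuous_on UNIV \<psi>" "\<And>x. 0 \<le> \<psi> x" and "0 \<le> t"
    and near: "\<And>a. (\<forall>i<p. dist (z i) (a i) < \<delta>) \<Longrightarrow> t \<le> \<psi> (prepend p a x)"
  shows "(exp (- F) * b) ^ p * t \<le> (L ^^ p) \<psi> x"
  using near
proof (induction p arbitrary: x)
  case 0
  then show ?case by simp
next
  case (Suc p)
  let ?q = "(exp (- F) * b) ^ p * t"
  have q: "0 \<le> ?q" using b(1) \<open>0 \<le> t\<close> by simp
  have meas: "ball (z p) \<delta> \<in> sets \<mu>" by (simp add: sets_\<mu>)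
  have nonneg: "0 \<le> (L ^^ p) \<psi> u" for u
    using iterate_mono[of "\<lambda>_. 0 * 1" \<psi> p u] \<psi> unfolding iterate_scale by simp
  have pointwise: "exp (- F) * ?q * indicator (ball (z p) \<delta>) a \<le> exp (f (cons_seq a x)) * (L ^^ p) \<psi> (cons_seq a x)" for a
  proof (cases "a \<in> ball (z p) \<delta>")
    case True
    have "?q \<le> (L ^^ p) \<psi> (cons_seq a x)"
    proof (rule Suc.IH)
      fix c assume "\<forall>i<p. dist (z i) (c i) < \<delta>"
      then show "t \<le> \<psi> (prepend p c (cons_seq a x))"
        using Suc.prems[of "c(p := a)"] True unfolding prepend_Suc by (simp add: less_Suc_eq)
    qed
    moreover have "exp (- F) \<le> exp (f (cons_seq a x))"
      using spec[OF F, of "cons_seq a x"] by simp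
    ultimately show ?thesis using True q by (simp add: mult_mono)
  qed (simp add: nonneg)
  have int: "integrable \<mu> (indicat_real (ball (z p) \<delta>))"
    using meas by (intro integrable_real_indicator) (auto simp: less_top[symmetric])
  have "(exp (- F) * b) ^ Suc p * t \<le> exp (- F) * ?q * measure \<mu> (ball (z p) \<delta>)"
    using mult_left_mono[OF spec[OF b(2), of "z p"] mult_nonneg_nonneg[OF exp_ge_zero[of "- F"] q]]
    by (simp add: mult_ac)
  also have "\<dots> = (\<integral>a. exp (- F) * ?q * indicator (ball (z p) \<delta>) a \<partial>\<mu>)"
    using meas by simp
  also have "\<dots> \<le> (\<integral>a. exp (f (cons_seq a x)) * (L ^^ p) \<psi> (cons_seq a x) \<partial>\<mu>)"
    by (intro integral_mono pointwise integrable_mult_right int integrable_ruelle iterate_cont \<psi>(1))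
  finally show ?case by (simp add: ruelle_def[of \<mu> f "(L ^^ p) \<psi>"])
qed

text \<open>Families rather than single functions, because the eigenfunction needs decay uniform
  over all \<open>normalized_iterate k\<close>. Nonnegativity lets multiplicative estimates of the
  weights be combined with bounds on \<open>\<phi>\<close>.\<close>

definition bounded_equicontinuous :: "real \<Rightarrow> ((nat \<Rightarrow> 'a) \<Rightarrow> real) set \<Rightarrow> bool" where
  "bounded_equicontinuous B \<Phi> \<longleftrightarrow>
    (\<forall>\<phi>\<in>\<Phi>. continuous_on UNIV \<phi> \<and> (\<forall>x. 0 \<le> \<phi> x \<and> \<phi> x \<le> B)) \<and>
    (\<forall>e>0. \<exists>d>0. \<forall>\<phi>\<in>\<Phi>. \<forall>x y. dist x y < d \<longrightarrow> \<phi> x \<le> \<phi> y + e)"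

lemma bounded_equicontinuousD:
  assumes "bounded_equicontinuous B \<Phi>"
  shows "\<phi> \<in> \<Phi> \<Longrightarrow> continuous_on UNIV \<phi>" "\<phi> \<in> \<Phi> \<Longrightarrow> 0 \<le> \<phi> x" "\<phi> \<in> \<Phi> \<Longrightarrow> \<phi> x \<le> B"
    "0 < e \<Longrightarrow> \<exists>d>0. \<forall>\<phi>\<in>\<Phi>. \<forall>x y. dist x y < d \<longrightarrow> \<phi> x \<le> \<phi> y + e"
  using assms by (simp_all add: bounded_equicontinuous_def)

text \<open>Three errors add up: the weights of the words change by a factor \<open>exp t\<close>,
  the denominators by another \<open>exp t\<close>, and \<open>\<phi>\<close> by \<open>t\<close>.
  As ratios stay at most \<open>B\<close>, the multiplicative errors turn into additive ones, and
  the total tends to 0 with \<open>t\<close>.\<close>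

lemma ratio_equicontinuous:
  assumes family: "bounded_equicontinuous B \<Phi>" and "0 < e"
  shows "\<exists>d>0. \<forall>\<phi>\<in>\<Phi>. \<forall>n x y. dist x y < d \<longrightarrow> ratio n \<phi> x \<le> ratio n \<phi> y + e"
proof -
  note \<Phi> = bounded_equicontinuousD[OF family]
  have "((\<lambda>t. (exp (2 * t) - 1) * B + exp (2 * t) * t) \<longlongrightarrow> (exp (2 * 0) - 1) * B + exp (2 * 0) * 0) (at_right (0::real))"
    by (intro tendsto_intros)
  then have "\<forall>\<^sub>F t in at_right 0. (exp (2 * t) - 1) * B + exp (2 * t) * t < e"
    using \<open>0 < e\<close> by (intro order_tendstoD(2)) auto
  then obtain t0 where "0 < t0" "\<forall>t>0. t < t0 \<longrightarrow> (exp (2 * t) - 1) * B + exp (2 * t) * t < e"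
    unfolding eventually_at_right_field by blast
  then obtain t where t: "0 < t" "(exp (2 * t) - 1) * B + exp (2 * t) * t < e"
    using field_lbound_gt_zero[of t0 t0] by blast
  obtain d1 where d1: "0 < d1"
    "\<forall>x y n a. dist x y < d1 \<longrightarrow> birkhoff_sum f n (prepend n a x) - birkhoff_sum f n (prepend n a y) \<le> t"
    by (rule weak_walters_distortion[OF compact_alphabet walters t(1)])
  obtain d2 where d2: "0 < d2"
    "\<forall>x y n. dist x y < d2 \<longrightarrow> (L ^^ n) (\<lambda>_. 1) x \<le> exp t * (L ^^ n) (\<lambda>_. 1) y"
    by (rule iterate_one_near[OF t(1)])
  obtain d3 where d3: "0 < d3" "\<forall>\<phi>\<in>\<Phi>. \<forall>x y. dist x y < d3 \<longrightarrow> \<phi> x \<le> \<phi> y + t"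
    using \<Phi>(4)[OF t(1)] by blast
  obtain d4 where d4: "0 < d4"
    "\<forall>(x :: nat \<Rightarrow> 'a) y n a. dist x y < d4 \<longrightarrow> dist (prepend n a x) (prepend n a y) < d3"
    by (rule prepend_close[OF compact_alphabet d3(1)])
  define d where "d = min d1 (min d2 d4)"
  have "ratio n \<phi> x \<le> ratio n \<phi> y + e" if "\<phi> \<in> \<Phi>" "dist x y < d" for \<phi> n x y
  proof -
    note c = \<Phi>(1)[OF that(1)]
    have xy: "dist x y < d1" "dist y x < d2" "dist x y < d4"
      using that(2) by (auto simp: d_def dist_commute)
    have "(L ^^ n) \<phi> x \<le> exp t * (L ^^ n) (\<lambda>u. \<phi> u + t * 1) y"
    proof (rule iterate_compare)
      fix a
      have "birkhoff_sum f n (prepend n a x) \<le> t + birkhoff_sum f n (prepend n a y)"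
        using d1(2) xy(1) by (metis diff_le_eq)
      then have "exp (birkhoff_sum f n (prepend n a x)) \<le> exp t * exp (birkhoff_sum f n (prepend n a y))"
        by (simp flip: exp_add)
      moreover have "\<phi> (prepend n a x) \<le> \<phi> (prepend n a y) + t * 1"
        using d3(2) that(1) d4(2) xy(3) by simp
      ultimately have "exp (birkhoff_sum f n (prepend n a x)) * \<phi> (prepend n a x)
        \<le> (exp t * exp (birkhoff_sum f n (prepend n a y))) * (\<phi> (prepend n a y) + t * 1)"
        using \<Phi>(2)[OF that(1)] by (intro mult_mono) auto
      then show "exp (birkhoff_sum f n (prepend n a x)) * \<phi> (prepend n a x)
        \<le> exp t * (exp (birkhoff_sum f n (prepend n a y)) * (\<phi> (prepend n a y) + t * 1))"
        by (simp only: mult.assoc)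
    qed (use c in \<open>auto intro!: continuous_intros\<close>)
    also have "(L ^^ n) (\<lambda>u. \<phi> u + t * 1) y = (L ^^ n) \<phi> y + t * (L ^^ n) (\<lambda>_. 1) y"
      using iterate_add[OF c, of "\<lambda>_. t * 1" n] iterate_scale[of n t "\<lambda>_. 1"] by simp
    also have "\<dots> = (ratio n \<phi> y + t) * (L ^^ n) (\<lambda>_. 1) y"
      using iterate_one_pos[of n y] by (simp add: field_simps)
    finally have 1: "(L ^^ n) \<phi> x \<le> exp t * ((ratio n \<phi> y + t) * (L ^^ n) (\<lambda>_. 1) y)" .
    have ry: "0 \<le> ratio n \<phi> y" "ratio n \<phi> y \<le> B"
      using iterate_mono[of "\<lambda>_. 0 * 1" \<phi> n y] iterate_mono[of \<phi> "\<lambda>_. B * 1" n y] \<Phi>(2,3)[OF that(1)] c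
        iterate_one_pos[of n y]
      unfolding iterate_scale by (auto simp: field_simps)
    have "(ratio n \<phi> y + t) * (L ^^ n) (\<lambda>_. 1) y \<le> (ratio n \<phi> y + t) * (exp t * (L ^^ n) (\<lambda>_. 1) x)"
      using d2(2) xy(2) ry(1) t(1) by (intro mult_left_mono) auto
    then have "(L ^^ n) \<phi> x \<le> exp t * ((ratio n \<phi> y + t) * (exp t * (L ^^ n) (\<lambda>_. 1) x))"
      using 1 by (meson exp_ge_zero mult_left_mono order_trans)
    then have "ratio n \<phi> x \<le> exp t * exp t * (ratio n \<phi> y + t)"
      using iterate_one_pos[of n x] by (simp add: pos_divide_le_eq mult_ac)
    also have "exp t * exp t = exp (2 * t)" by (simp flip: exp_add)
    also have "exp (2 * t) * (ratio n \<phi> y + t) = ratio n \<phi> y + (exp (2 * t) - 1) * ratio n \<phi> y + exp (2 * t) * t"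
      by (simp only: distrib_left left_diff_distrib)
    also have "\<dots> \<le> ratio n \<phi> y + (exp (2 * t) - 1) * B + exp (2 * t) * t"
      using t(1) by (intro add_mono mult_left_mono ry(2)) auto
    finally show ?thesis using t(2) by linarith
  qed
  moreover have "0 < d" using d1 d2 d4 by (simp add: d_def)
  ultimately show ?thesis by blast
qed

text \<open>Positivity of \<open>L ^^ k\<close> applied to
  \<open>M * L ^^ m 1 - L ^^ m \<phi>\<close>: a later ratio is a weighted average of an earlier
  one.\<close>

lemma ratio_add_le:
  assumes "continuous_on UNIV \<phi>" "\<And>x. ratio m \<phi> x \<le> M"
  shows "ratio (m + k) \<phi> x \<le> M"
proof -
  have "(L ^^ m) \<phi> u \<le> M * (L ^^ m) (\<lambda>_. 1) u" for u
    using assms(2)[of u] iterate_one_pos[of m u] by (simp add: field_simps)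
  then have "(L ^^ k) ((L ^^ m) \<phi>) x \<le> (L ^^ k) (\<lambda>u. M * (L ^^ m) (\<lambda>_. 1) u) x"
    using assms(1) by (intro iterate_mono continuous_intros iterate_cont) auto
  then show ?thesis
    unfolding iterate_scale iterate_add_apply[symmetric]
    using iterate_one_pos[of "m + k" x] by (simp add: field_simps)
qed

lemma ratio_minus: "ratio n (\<lambda>x. - \<phi> x) x = - ratio n \<phi> x"
  using iterate_scale[of n "- 1" \<phi>] by simp

lemma ratio_add_ge:
  assumes "continuous_on UNIV \<phi>" "\<And>x. M \<le> ratio m \<phi> x"
  shows "M \<le> ratio (m + k) \<phi> x"
  using ratio_add_le[of "\<lambda>x. - \<phi> x" m "- M" k x] assms
  unfolding ratio_minus by (simp add: continuous_on_minus)

lemma ratio_cont: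
  assumes "continuous_on UNIV \<phi>"
  shows "continuous_on UNIV (ratio n \<phi>)"
  using assms iterate_one_pos[of n]
  by (intro continuous_on_divide iterate_cont) (auto simp: less_imp_neq[symmetric])

text \<open>Near a minimum of \<open>ratio m \<phi>\<close> the function \<open>M * L ^^ m 1 - L ^^ m \<phi>\<close> is large, and by full support
  the operator \<open>L ^^ p\<close> spreads a fixed proportion of this gain to every point.\<close>

lemma ratio_oscillation_step:
  assumes family: "bounded_equicontinuous B \<Phi>" and "0 < e"
  shows "\<exists>p c. 0 < c \<and> c \<le> 1 \<and> (\<forall>\<phi>\<in>\<Phi>. \<forall>m D. e \<le> D \<longrightarrow> (\<forall>x y. ratio m \<phi> x - ratio m \<phi> y \<le> D) \<longrightarrow>
    (\<forall>x y. ratio (m + p) \<phi> x - ratio (m + p) \<phi> y \<le> D - c * (D - e)))"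
proof -
  note \<Phi> = bounded_equicontinuousD[OF family]
  obtain F where F: "0 \<le> F" "\<forall>x. \<bar>f x\<bar> \<le> F" by (rule potential_bounded)
  obtain K where K: "1 \<le> K" "\<forall>n x y. (L ^^ n) (\<lambda>_. 1) x \<le> K * (L ^^ n) (\<lambda>_. 1) y"
    by (rule iterate_one_harnack)
  obtain d where d: "0 < d" "\<forall>\<phi>\<in>\<Phi>. \<forall>n x y. dist x y < d \<longrightarrow> ratio n \<phi> x \<le> ratio n \<phi> y + e"
    using ratio_equicontinuous[OF assms] by blast
  obtain p \<delta> where \<delta>: "0 < \<delta>"
    "\<forall>x y :: nat \<Rightarrow> 'a. (\<forall>i<p. dist (x i) (y i) < \<delta>) \<longrightarrow> dist x y < d"
    using sequences_close_if_coordinates_close[OF d(1)] by blast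
  obtain b where b: "0 < b" "\<forall>z. b \<le> measure \<mu> (ball z \<delta>)"
    by (rule measure_ball_bounded_below[OF \<delta>(1)])
  define q where "q = (exp (- F) * b) ^ p"
  \<comment> \<open>One factor \<open>K\<close> bounds \<open>L ^^ m 1\<close> near the minimum
    point \<open>z\<close> from below by \<open>s / K\<close>; the other, with
    \<open>exp (real p * F)\<close>, bounds the denominator \<open>L ^^ (m + p) 1\<close> from
    above.\<close>
  define c where "c = q / (K * K * exp (real p * F))"
  have "b \<le> 1" using b(2) by (meson prob_le_1 order_trans)
  then have "exp (- F) * b \<le> 1" using F(1) b(1) by (intro mult_le_one) auto
  then have q: "0 < q" "q \<le> 1" using b(1) by (auto simp: q_def power_le_one)
  have KK: "1 \<le> K * K * exp (real p * F)"
    using K(1) F(1) mult_mono[of 1 K 1 K] mult_mono[of 1 "K * K" 1 "exp (real p * F)"] by simp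
  have c: "0 < c" "c \<le> 1"
    using q KK K(1) by (auto simp: c_def field_simps intro: order_trans)
  have "ratio (m + p) \<phi> x - ratio (m + p) \<phi> y \<le> D - c * (D - e)"
    if \<phi>: "\<phi> \<in> \<Phi>" and D: "e \<le> D" "\<forall>x y. ratio m \<phi> x - ratio m \<phi> y \<le> D" for \<phi> m D x y
  proof -
    note cont = \<Phi>(1)[OF \<phi>]
    obtain z where z: "\<And>u. ratio m \<phi> z \<le> ratio m \<phi> u"
      using continuous_attains_inf[OF compact_sequences _ ratio_cont[OF cont]] by auto
    obtain w where w: "\<And>u. ratio m \<phi> u \<le> ratio m \<phi> w"
      using continuous_attains_sup[OF compact_sequences _ ratio_cont[OF cont]] by auto
    define G where "G = ratio m \<phi> w - ratio m \<phi> z"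
    have lower: "ratio m \<phi> z \<le> ratio (m + p) \<phi> y"
      by (rule ratio_add_ge[OF cont z])
    have upper: "ratio (m + p) \<phi> x \<le> ratio m \<phi> w"
      by (rule ratio_add_le[OF cont w])
    have "G \<le> D" using D(2) by (simp add: G_def)
    show ?thesis
    proof (cases "G \<le> e")
      case True
      \<comment> \<open>If the oscillation is already at most \<open>e\<close>, monotonicity
        suffices, because \<open>D - c * (D - e)\<close> is at least \<open>e\<close>.\<close>
      have "c * (D - e) \<le> D - e" using c D(1) by (intro mult_left_le_one_le) auto
      then show ?thesis using lower upper True by (simp add: G_def)
    next
      case False
      define s where "s = (L ^^ m) (\<lambda>_. 1) z"
      have s: "0 < s" unfolding s_def by (rule iterate_one_pos)
      define \<psi> where "\<psi> u = ratio m \<phi> w * (L ^^ m) (\<lambda>_. 1) u + - 1 * (L ^^ m) \<phi> u" for u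
      have \<psi>_eq: "\<psi> u = (ratio m \<phi> w - ratio m \<phi> u) * (L ^^ m) (\<lambda>_. 1) u" for u
        using iterate_one_pos[of m u] by (simp add: \<psi>_def field_simps)
      have \<psi>_cont: "continuous_on UNIV \<psi>"
        unfolding \<psi>_def using cont by (intro continuous_intros iterate_cont) auto
      have "q * ((G - e) * (s / K)) \<le> (L ^^ p) \<psi> x"
        unfolding q_def
      proof (rule iterate_lower_bound[OF F(2) b \<psi>_cont])
        show "0 \<le> \<psi> u" for u
          unfolding \<psi>_eq using w[of u] iterate_one_pos[of m u] by simp
        show "0 \<le> (G - e) * (s / K)" using False s K(1) by simp
        fix a assume a: "\<forall>i<p. dist (z i) (a i) < \<delta>"
        let ?v = "prepend p a x"
        have "dist ?v z < d"
          using \<delta>(2) a by (simp add: prepend_def dist_commute)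
        then have "ratio m \<phi> ?v \<le> ratio m \<phi> z + e" using d(2) \<phi> by blast
        then have "G - e \<le> ratio m \<phi> w - ratio m \<phi> ?v" by (simp add: G_def)
        moreover have "s / K \<le> (L ^^ m) (\<lambda>_. 1) ?v"
          using K s unfolding s_def by (simp add: field_simps)
        ultimately show "(G - e) * (s / K) \<le> \<psi> ?v"
          unfolding \<psi>_eq using False s K(1) by (intro mult_mono) auto
      qed
      also have "(L ^^ p) \<psi> x = ratio m \<phi> w * (L ^^ (m + p)) (\<lambda>_. 1) x - (L ^^ (m + p)) \<phi> x"
      proof -
        have "(L ^^ p) \<psi> = (\<lambda>x. (L ^^ p) (\<lambda>u. ratio m \<phi> w * (L ^^ m) (\<lambda>_. 1) u) x + (L ^^ p) (\<lambda>u. - 1 * (L ^^ m) \<phi> u) x)"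
          unfolding \<psi>_def using cont by (intro iterate_add continuous_intros iterate_cont) auto
        then show ?thesis
          unfolding iterate_scale iterate_add_apply by simp
      qed
      also have "\<dots> = (ratio m \<phi> w - ratio (m + p) \<phi> x) * (L ^^ (m + p)) (\<lambda>_. 1) x"
        using iterate_one_pos[of "m + p" x] by (simp add: field_simps)
      also have "\<dots> \<le> (ratio m \<phi> w - ratio (m + p) \<phi> x) * (K * s * exp (real p * F))"
      proof (rule mult_left_mono)
        have "(L ^^ (m + p)) (\<lambda>_. 1) x \<le> (L ^^ p) (\<lambda>_. K * s * 1) x"
          unfolding iterate_add_apply using K(2) by (intro iterate_mono iterate_cont) (auto simp: s_def)
        also have "\<dots> \<le> K * s * exp (real p * F)"
          unfolding iterate_scale using K(1) s by (intro mult_left_mono iterate_one_bounds(2)[OF F(2)]) auto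
        finally show "(L ^^ (m + p)) (\<lambda>_. 1) x \<le> K * s * exp (real p * F)" .
      qed (use upper in simp)
      finally have "q * (G - e) / K * s \<le> (ratio m \<phi> w - ratio (m + p) \<phi> x) * (K * exp (real p * F)) * s"
        by (simp add: mult_ac)
      then have "q * (G - e) / K \<le> (ratio m \<phi> w - ratio (m + p) \<phi> x) * (K * exp (real p * F))"
        using s by (simp only: mult_le_cancel_right_pos)
      then have "c * (G - e) \<le> ratio m \<phi> w - ratio (m + p) \<phi> x"
        using K(1) unfolding c_def by (simp add: field_simps)
      then have "ratio (m + p) \<phi> x - ratio (m + p) \<phi> y \<le> G - c * (G - e)"
        using lower by (simp add: G_def)
      \<comment> \<open>The map \<open>D \<mapsto> D - c * (D - e)\<close> is nondecreasing since
        \<open>c \<le> 1\<close>, so the bound for the exact oscillation \<open>G\<close> carries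
        over to \<open>D\<close>.\<close>
      also have "\<dots> \<le> D - c * (D - e)"
        using mult_right_mono[of c 1 "D - G"] c \<open>G \<le> D\<close> by (simp add: algebra_simps)
      finally show ?thesis .
    qed
  qed
  then show ?thesis using c by blast
qed

lemma ratio_oscillation_mono:
  assumes "continuous_on UNIV \<phi>" "\<And>x y. ratio m \<phi> x - ratio m \<phi> y \<le> D" "m \<le> n"
  shows "\<bar>ratio n \<phi> x - ratio m \<phi> y\<bar> \<le> D" "ratio n \<phi> x - ratio n \<phi> y \<le> D"
proof -
  obtain k where n: "n = m + k" using assms(3) le_Suc_ex by blast
  have up: "ratio n \<phi> x \<le> ratio m \<phi> y + D" for x y
    unfolding n by (rule ratio_add_le[OF assms(1)]) (use assms(2) in \<open>simp add: algebra_simps\<close>)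
  have lo: "ratio m \<phi> y - D \<le> ratio n \<phi> x" for x y
    unfolding n by (rule ratio_add_ge[OF assms(1)]) (use assms(2) in \<open>simp add: algebra_simps\<close>)
  show "\<bar>ratio n \<phi> x - ratio m \<phi> y\<bar> \<le> D" using up[of x y] lo[of y x] by linarith
  have "ratio n \<phi> x - D \<le> ratio n \<phi> y"
    unfolding n by (rule ratio_add_ge[OF assms(1)]) (use up[of x] in \<open>simp add: n algebra_simps\<close>)
  then show "ratio n \<phi> x - ratio n \<phi> y \<le> D" by simp
qed

text \<open>The step lemma is run with tolerance \<open>e / 2\<close>, the fixed point of
  \<open>D \<mapsto> D - c * (D - e / 2)\<close>; after \<open>j\<close> rounds the oscillation is
  at most \<open>e / 2 + (1 - c) ^ j * B\<close>. The time \<open>j * p\<close> is the same for the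
  whole family.\<close>

lemma ratio_oscillation_decay:
  assumes family: "bounded_equicontinuous B \<Phi>" and "0 < e"
  shows "\<exists>N. \<forall>\<phi>\<in>\<Phi>. \<forall>n\<ge>N. \<forall>x y. ratio n \<phi> x - ratio n \<phi> y \<le> e"
proof (cases "\<Phi> = {}")
  case False
  note \<Phi> = bounded_equicontinuousD[OF family]
  obtain \<phi>0 where "\<phi>0 \<in> \<Phi>" using False by blast
  then have "0 \<le> B" using \<Phi>(2)[of \<phi>0 undefined] \<Phi>(3)[of \<phi>0 undefined] by linarith
  obtain p c where c: "0 < c" "c \<le> 1" and step: "\<forall>\<phi>\<in>\<Phi>. \<forall>m D. e / 2 \<le> D \<longrightarrow>
    (\<forall>x y. ratio m \<phi> x - ratio m \<phi> y \<le> D) \<longrightarrow> (\<forall>x y. ratio (m + p) \<phi> x - ratio (m + p) \<phi> y \<le> D - c * (D - e / 2))"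
    using ratio_oscillation_step[OF family half_gt_zero[OF \<open>0 < e\<close>]] by blast
  have iter: "\<forall>x y. ratio (j * p) \<phi> x - ratio (j * p) \<phi> y \<le> e / 2 + (1 - c) ^ j * B" if "\<phi> \<in> \<Phi>" for j \<phi>
  proof (induction j)
    case 0
    have "\<phi> x - \<phi> y \<le> e / 2 + B" for x y
      using \<Phi>(3)[OF that, of x] \<Phi>(2)[OF that, of y] \<open>0 < e\<close> by linarith
    then show ?case by simp
  next
    case (Suc j)
    have "e / 2 \<le> e / 2 + (1 - c) ^ j * B" using c \<open>0 \<le> B\<close> by simp
    with step that Suc have "\<forall>x y. ratio (j * p + p) \<phi> x - ratio (j * p + p) \<phi> y
      \<le> e / 2 + (1 - c) ^ j * B - c * (e / 2 + (1 - c) ^ j * B - e / 2)"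
      by blast
    moreover have "e / 2 + (1 - c) ^ j * B - c * (e / 2 + (1 - c) ^ j * B - e / 2) = e / 2 + (1 - c) ^ Suc j * B"
      by (simp add: algebra_simps)
    moreover have "j * p + p = Suc j * p" by simp
    ultimately show ?case by (simp only: simp_thms)
  qed
  have "(\<lambda>j. (1 - c) ^ j * B) \<longlonglongrightarrow> 0 * B"
    using c by (intro tendsto_mult LIMSEQ_power_zero tendsto_const) auto
  then have "\<forall>\<^sub>F j in sequentially. (1 - c) ^ j * B < e / 2"
    using \<open>0 < e\<close> by (intro order_tendstoD(2)) auto
  then obtain j where j: "(1 - c) ^ j * B < e / 2"
    by (auto simp: eventually_sequentially)
  show ?thesis
  proof (intro exI[of _ "j * p"] ballI allI impI)
    fix \<phi> n x y assume \<phi>: "\<phi> \<in> \<Phi>" and n: "j * p \<le> n"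
    have "ratio (j * p) \<phi> x - ratio (j * p) \<phi> y \<le> e" for x y
      using iter[OF \<phi>, of j, rule_format, of x y] j by linarith
    then show "ratio n \<phi> x - ratio n \<phi> y \<le> e"
      by (rule ratio_oscillation_mono(2)[OF \<Phi>(1)[OF \<phi>] _ n])
  qed
qed simp

section \<open>The limit functional and the eigenvalue\<close>

lemma ratio_const: "ratio n (\<lambda>_. c) x = c"
  using iterate_scale[of n c "\<lambda>_. 1"] iterate_one_pos[of n x] by simp

lemma ratio_plus:
  assumes "continuous_on UNIV \<phi>" "continuous_on UNIV \<psi>"
  shows "ratio n (\<lambda>x. \<phi> x + \<psi> x) x = ratio n \<phi> x + ratio n \<psi> x"
  by (simp add: iterate_add[OF assms] add_divide_distrib)

lemma ratio_scale: "ratio n (\<lambda>x. c * \<phi> x) x = c * ratio n \<phi> x"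
  by (simp add: iterate_scale)

lemma ratio_oscillation_continuous:
  assumes \<phi>: "continuous_on UNIV \<phi>" and "0 < e"
  shows "\<exists>N. \<forall>n\<ge>N. \<forall>x y. ratio n \<phi> x - ratio n \<phi> y \<le> e"
proof -
  obtain B where B: "\<forall>x. \<bar>\<phi> x\<bar> \<le> B"
    by (rule continuous_on_compact_UNIV_bounded[OF compact_sequences \<phi>])
  have uc: "uniformly_continuous_on UNIV \<phi>"
    by (rule compact_uniformly_continuous[OF \<phi> compact_sequences])
  \<comment> \<open>Adding the bound \<open>B\<close> makes the function nonnegative and shifts
    every ratio by \<open>B\<close>, leaving oscillations unchanged.\<close>
  have "bounded_equicontinuous (2 * B) {\<lambda>x. \<phi> x + B}"
    unfolding bounded_equicontinuous_def
  proof (intro conjI ballI allI impI)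
    fix \<psi> x assume "\<psi> \<in> {\<lambda>x. \<phi> x + B}"
    then have \<psi>: "\<psi> = (\<lambda>x. \<phi> x + B)" by simp
    show "continuous_on UNIV \<psi>" unfolding \<psi> using \<phi> by (intro continuous_intros)
    show "0 \<le> \<psi> x" "\<psi> x \<le> 2 * B" using spec[OF B, of x] by (auto simp: \<psi>)
  next
    fix e :: real assume "0 < e"
    then obtain d where d: "0 < d" "\<And>x y. dist y x < d \<Longrightarrow> dist (\<phi> y) (\<phi> x) < e"
      using uc unfolding uniformly_continuous_on_def by (metis UNIV_I)
    have "\<phi> x \<le> \<phi> y + e" if "dist x y < d" for x y
      using d(2)[OF that] by (simp add: dist_real_def)
    then show "\<exists>d>0. \<forall>\<psi>\<in>{\<lambda>x. \<phi> x + B}. \<forall>x y. dist x y < d \<longrightarrow> \<psi> x \<le> \<psi> y + e"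
      using d(1) by (intro exI[of _ d]) auto
  qed
  from ratio_oscillation_decay[OF this \<open>0 < e\<close>]
  obtain N where N: "\<forall>n\<ge>N. \<forall>x y. ratio n (\<lambda>x. \<phi> x + B) x - ratio n (\<lambda>x. \<phi> x + B) y \<le> e"
    by auto
  have "ratio n (\<lambda>x. \<phi> x + B) x = ratio n \<phi> x + B" for n x
    using ratio_plus[OF \<phi>, of "\<lambda>_. B" n x] ratio_const[of n B x] by simp
  then show ?thesis using N by auto
qed

text \<open>\<open>undefined\<close> serves as an arbitrary base point; for continuous
  \<open>\<phi>\<close> the oscillations vanish in the limit, so every other point has the same
  limit.\<close>

definition eigenfunctional :: "((nat \<Rightarrow> 'a) \<Rightarrow> real) \<Rightarrow> real" where
  "eigenfunctional \<phi> = lim (\<lambda>n. ratio n \<phi> undefined)"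

lemma ratio_limit:
  assumes \<phi>: "continuous_on UNIV \<phi>"
  shows "(\<lambda>n. ratio n \<phi> undefined) \<longlonglongrightarrow> eigenfunctional \<phi>"
proof -
  have "Cauchy (\<lambda>n. ratio n \<phi> undefined)"
  proof (rule metric_CauchyI)
    fix e :: real assume "0 < e"
    then obtain N where "\<forall>n\<ge>N. \<forall>x y. ratio n \<phi> x - ratio n \<phi> y \<le> e / 3"
      using ratio_oscillation_continuous[OF \<phi>, of "e / 3"] by auto
    then have N: "ratio N \<phi> x - ratio N \<phi> y \<le> e / 3" for x y by blast
    have "dist (ratio m \<phi> undefined) (ratio n \<phi> undefined) < e" if "N \<le> m" "N \<le> n" for m n
      using ratio_oscillation_mono(1)[OF \<phi> N that(1), of undefined undefined]
        ratio_oscillation_mono(1)[OF \<phi> N that(2), of undefined undefined] \<open>0 < e\<close>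
      unfolding dist_real_def by linarith
    then show "\<exists>M. \<forall>m\<ge>M. \<forall>n\<ge>M. dist (ratio m \<phi> undefined) (ratio n \<phi> undefined) < e" by blast
  qed
  then show ?thesis
    unfolding eigenfunctional_def by (simp add: Cauchy_convergent convergent_LIMSEQ_iff[symmetric])
qed

text \<open>The error at time \<open>m\<close> is controlled by the oscillation at time
  \<open>m\<close> alone, whatever \<open>\<phi>\<close> is; this turns decay over a family into
  convergence uniform over the family.\<close>

lemma ratio_close_eigenfunctional:
  assumes \<phi>: "continuous_on UNIV \<phi>" and osc: "\<And>x y. ratio m \<phi> x - ratio m \<phi> y \<le> D"
  shows "\<bar>ratio m \<phi> x - eigenfunctional \<phi>\<bar> \<le> D"
proof -
  have "(\<lambda>n. \<bar>ratio n \<phi> undefined - ratio m \<phi> x\<bar>) \<longlonglongrightarrow> \<bar>eigenfunctional \<phi> - ratio m \<phi> x\<bar>"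
    by (intro tendsto_intros ratio_limit \<phi>)
  then have "\<bar>eigenfunctional \<phi> - ratio m \<phi> x\<bar> \<le> D"
    using ratio_oscillation_mono(1)[OF \<phi> osc] by (intro LIMSEQ_le_const2) blast+
  then show ?thesis by linarith
qed

lemma ratio_uniform_limit:
  assumes "continuous_on UNIV \<phi>" "0 < e"
  shows "\<exists>N. \<forall>n\<ge>N. \<forall>x. \<bar>ratio n \<phi> x - eigenfunctional \<phi>\<bar> \<le> e"
  using ratio_oscillation_continuous[OF assms] ratio_close_eigenfunctional[OF assms(1)] by meson

text \<open>Linearity and positivity pass from the ratios to the limit. Through this interpretation
  \<open>riesz_measure\<close> becomes the eigenmeasure.\<close>

sublocale normalized_positive_functional eigenfunctional
proof
  show "compact (UNIV :: (nat \<Rightarrow> 'a) set)" by (rule compact_sequences)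
  show "eigenfunctional (\<lambda>x. \<phi> x + \<psi> x) = eigenfunctional \<phi> + eigenfunctional \<psi>"
    if "continuous_on UNIV \<phi>" "continuous_on UNIV \<psi>" for \<phi> \<psi>
  proof (rule LIMSEQ_unique)
    show "(\<lambda>n. ratio n (\<lambda>x. \<phi> x + \<psi> x) undefined) \<longlonglongrightarrow> eigenfunctional (\<lambda>x. \<phi> x + \<psi> x)"
      using that by (intro ratio_limit continuous_intros)
    show "(\<lambda>n. ratio n (\<lambda>x. \<phi> x + \<psi> x) undefined) \<longlonglongrightarrow> eigenfunctional \<phi> + eigenfunctional \<psi>"
      unfolding ratio_plus[OF that] using that by (intro tendsto_intros ratio_limit)
  qed
  show "eigenfunctional (\<lambda>x. c * \<phi> x) = c * eigenfunctional \<phi>" if "continuous_on UNIV \<phi>" for c \<phi>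
  proof (rule LIMSEQ_unique)
    show "(\<lambda>n. ratio n (\<lambda>x. c * \<phi> x) undefined) \<longlonglongrightarrow> eigenfunctional (\<lambda>x. c * \<phi> x)"
      using that by (intro ratio_limit continuous_intros)
    show "(\<lambda>n. ratio n (\<lambda>x. c * \<phi> x) undefined) \<longlonglongrightarrow> c * eigenfunctional \<phi>"
      unfolding ratio_scale using that by (intro tendsto_intros ratio_limit)
  qed
  show "0 \<le> eigenfunctional \<phi>" if "continuous_on UNIV \<phi>" "\<And>x. 0 \<le> \<phi> x" for \<phi>
  proof (rule LIMSEQ_le_const[OF ratio_limit[OF that(1)]], intro exI allI impI)
    show "0 \<le> ratio n \<phi> undefined" for n
      using ratio_add_ge[OF that(1), of 0 0 n undefined] that(2) by simp
  qed
  show "eigenfunctional (\<lambda>_. 1) = 1"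
    using LIMSEQ_unique[OF ratio_limit[of "\<lambda>_. 1"]] ratio_const[of _ 1 undefined] by simp
qed

text \<open>Forced by the dual equation: tested on the constant 1, it equates the eigenvalue with
  the integral of \<open>L 1\<close> against the probability measure.\<close>

definition eigenvalue :: real where
  "eigenvalue = eigenfunctional (L (\<lambda>_. 1))"

lemma eigenvalue_pos: "0 < eigenvalue"
proof -
  obtain F where F: "\<forall>x. \<bar>f x\<bar> \<le> F" by (rule potential_bounded)
  have "exp (- F) \<le> L (\<lambda>_. 1) x" for x
    using iterate_one_bounds(1)[OF F, of 1 x] by simp
  then have "eigenfunctional (\<lambda>_. exp (- F)) \<le> eigenvalue"
    unfolding eigenvalue_def by (intro mono ruelle_cont) auto
  then show ?thesis unfolding const by (meson exp_gt_zero less_le_trans)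
qed

text \<open>\<open>L ^^ n (L \<phi>) / L ^^ n 1\<close> factors as
  \<open>L ^^ n (L 1) / L ^^ n 1\<close> times \<open>L ^^ Suc n \<phi> / L ^^ Suc n 1\<close>, and
  each factor converges.\<close>

lemma eigenfunctional_ruelle:
  assumes \<phi>: "continuous_on UNIV \<phi>"
  shows "eigenfunctional (L \<phi>) = eigenvalue * eigenfunctional \<phi>"
proof (rule LIMSEQ_unique)
  show "(\<lambda>n. ratio n (L \<phi>) undefined) \<longlonglongrightarrow> eigenfunctional (L \<phi>)"
    by (intro ratio_limit ruelle_cont \<phi>)
  have "ratio n (L (\<lambda>_. 1)) undefined * ratio (Suc n) \<phi> undefined = ratio n (L \<phi>) undefined" for n
    using iterate_one_pos[of "Suc n" undefined] unfolding iterate_Suc_apply by simp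
  moreover have "(\<lambda>n. ratio n (L (\<lambda>_. 1)) undefined * ratio (Suc n) \<phi> undefined) \<longlonglongrightarrow> eigenvalue * eigenfunctional \<phi>"
    unfolding eigenvalue_def by (intro tendsto_mult ratio_limit LIMSEQ_Suc[OF ratio_limit] ruelle_cont \<phi>) simp
  ultimately show "(\<lambda>n. ratio n (L \<phi>) undefined) \<longlonglongrightarrow> eigenvalue * eigenfunctional \<phi>" by simp
qed

text \<open>The normalization gives every member the value 1 under \<open>eigenfunctional\<close>.
  The constant stands in front as a factor so that the scaling rules apply.\<close>

definition normalized_iterate :: "nat \<Rightarrow> (nat \<Rightarrow> 'a) \<Rightarrow> real" where
  "normalized_iterate n = (\<lambda>x. (1 / eigenvalue ^ n) * (L ^^ n) (\<lambda>_. 1) x)"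

lemma normalized_iterate_cont: "continuous_on UNIV (normalized_iterate n)"
  unfolding normalized_iterate_def by (intro continuous_intros iterate_cont)

lemma eigenfunctional_normalized_iterate: "eigenfunctional (normalized_iterate n) = 1"
proof -
  have "eigenfunctional ((L ^^ n) (\<lambda>_. 1)) = eigenvalue ^ n"
    by (induction n) (simp_all add: one eigenfunctional_ruelle iterate_cont)
  then show ?thesis
    unfolding normalized_iterate_def using eigenvalue_pos by (subst scale) (auto intro: iterate_cont)
qed

lemma ruelle_normalized_iterate: "L (normalized_iterate n) x = eigenvalue * normalized_iterate (Suc n) x"
  unfolding normalized_iterate_def ruelle_scale using eigenvalue_pos by simp

text \<open>Separates two limits: the ratio tends to the constant
  \<open>eigenfunctional \<phi>\<close>, the normalized iterate to the eigenfunction.\<close>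

lemma iterate_eq_ratio: "(L ^^ n) \<phi> x / eigenvalue ^ n = ratio n \<phi> x * normalized_iterate n x"
  using iterate_one_pos[of n x] by (simp add: normalized_iterate_def)

text \<open>Evaluating the Harnack inequality by \<open>eigenfunctional\<close> in one of its two
  variables removes that variable, because each normalized iterate has value 1.\<close>

lemma normalized_iterate_bounds:
  obtains K where "1 \<le> K" "\<forall>n x. 1 / K \<le> normalized_iterate n x \<and> normalized_iterate n x \<le> K"
proof -
  obtain K where K: "1 \<le> K" "\<forall>n x y. (L ^^ n) (\<lambda>_. 1) x \<le> K * (L ^^ n) (\<lambda>_. 1) y"
    by (rule iterate_one_harnack)
  have harnack: "normalized_iterate n x \<le> K * normalized_iterate n y" for n x y
  proof -
    have "(1 / eigenvalue ^ n) * (L ^^ n) (\<lambda>_. 1) x \<le> (1 / eigenvalue ^ n) * (K * (L ^^ n) (\<lambda>_. 1) y)"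
      using K(2) eigenvalue_pos by (intro mult_left_mono) auto
    then show ?thesis by (simp add: normalized_iterate_def mult_ac)
  qed
  show thesis
  proof (rule that[OF K(1)], intro allI conjI)
    fix n x
    have "eigenfunctional (\<lambda>_. normalized_iterate n x) \<le> eigenfunctional (\<lambda>y. K * normalized_iterate n y)"
      by (intro mono continuous_intros normalized_iterate_cont harnack)
    then show "normalized_iterate n x \<le> K"
      by (simp add: const scale normalized_iterate_cont eigenfunctional_normalized_iterate)
    have "eigenfunctional (normalized_iterate n) \<le> eigenfunctional (\<lambda>_. K * normalized_iterate n x)"
      by (intro mono continuous_intros normalized_iterate_cont harnack)
    then show "1 / K \<le> normalized_iterate n x"
      using K(1) by (simp add: const eigenfunctional_normalized_iterate field_simps)
  qed
qed

lemma normalized_iterate_equicontinuous: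
  obtains K where "bounded_equicontinuous K (range normalized_iterate)"
proof -
  obtain K where K: "1 \<le> K" "\<forall>n x. 1 / K \<le> normalized_iterate n x \<and> normalized_iterate n x \<le> K"
    by (rule normalized_iterate_bounds)
  have nonneg': "0 \<le> normalized_iterate n x" for n x
    using eigenvalue_pos iterate_one_pos[of n x] by (simp add: normalized_iterate_def)
  have "bounded_equicontinuous K (range normalized_iterate)"
    unfolding bounded_equicontinuous_def
  proof (intro conjI ballI allI impI)
    fix \<phi> x assume "\<phi> \<in> range normalized_iterate"
    then show "continuous_on UNIV \<phi>" "0 \<le> \<phi> x" "\<phi> x \<le> K"
      using normalized_iterate_cont nonneg' K(2) by auto
  next
    fix e :: real assume e: "0 < e"
    \<comment> \<open>With \<open>exp t = 1 + e / K\<close> the multiplicative bound at nearby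
      points costs at most \<open>e\<close>, the normalized iterates being at most
      \<open>K\<close>.\<close>
    define t where "t = ln (1 + e / K)"
    have "0 < e / K" using e K(1) by simp
    then have t: "0 < t" "exp t = 1 + e / K" by (simp_all add: t_def)
    obtain d where d: "0 < d"
      "\<forall>x y n. dist x y < d \<longrightarrow> (L ^^ n) (\<lambda>_. 1) x \<le> exp t * (L ^^ n) (\<lambda>_. 1) y"
      by (rule iterate_one_near[OF t(1)])
    have "normalized_iterate n x \<le> normalized_iterate n y + e" if "dist x y < d" for n x y
    proof -
      have "(1 / eigenvalue ^ n) * (L ^^ n) (\<lambda>_. 1) x \<le> (1 / eigenvalue ^ n) * (exp t * (L ^^ n) (\<lambda>_. 1) y)"
        using d(2) that eigenvalue_pos by (intro mult_left_mono) auto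
      then have "normalized_iterate n x \<le> (1 + e / K) * normalized_iterate n y"
        unfolding normalized_iterate_def t(2) by (simp add: mult_ac)
      also have "\<dots> = normalized_iterate n y + e / K * normalized_iterate n y"
        by (simp add: distrib_right)
      also have "e / K * normalized_iterate n y \<le> e / K * K"
        using K e by (intro mult_left_mono) auto
      finally show ?thesis using K(1) by simp
    qed
    then show "\<exists>d>0. \<forall>\<phi>\<in>range normalized_iterate. \<forall>x y. dist x y < d \<longrightarrow> \<phi> x \<le> \<phi> y + e"
      using d(1) by (intro exI[of _ d]) auto
  qed
  then show thesis by (rule that)
qed

text \<open>The oscillation decay is uniform over the family of all \<open>normalized_iterate k\<close>, and
  \<open>ratio n (normalized_iterate k)\<close> is the quotient of \<open>normalized_iterate (n + k)\<close> by
  \<open>normalized_iterate n\<close>; hence the sequence is uniformly Cauchy.\<close>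

lemma normalized_iterate_uniformly_convergent: "uniformly_convergent_on UNIV normalized_iterate"
proof (rule Cauchy_uniformly_convergent, rule uniformly_Cauchy_onI')
  fix e :: real assume e: "0 < e"
  obtain K where K: "1 \<le> K" "\<forall>n x. 1 / K \<le> normalized_iterate n x \<and> normalized_iterate n x \<le> K"
    by (rule normalized_iterate_bounds)
  obtain B where B: "bounded_equicontinuous B (range normalized_iterate)"
    by (rule normalized_iterate_equicontinuous)
  have "0 < e / (2 * K)" using e K(1) by simp
  from ratio_oscillation_decay[OF B this]
  obtain N where N: "\<forall>k. \<forall>n\<ge>N. \<forall>x y. ratio n (normalized_iterate k) x - ratio n (normalized_iterate k) y \<le> e / (2 * K)"
    by auto
  have close: "\<bar>normalized_iterate (n + k) x - normalized_iterate n x\<bar> < e" if "N \<le> n" for n k x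
  proof -
    have "\<bar>ratio n (normalized_iterate k) x - 1\<bar> \<le> e / (2 * K)"
      using ratio_close_eigenfunctional[OF normalized_iterate_cont[of k], of n "e / (2 * K)" x] N that
      unfolding eigenfunctional_normalized_iterate by blast
    moreover have "normalized_iterate (n + k) x = ratio n (normalized_iterate k) x * normalized_iterate n x"
    proof -
      have "(L ^^ n) (normalized_iterate k) x = (1 / eigenvalue ^ k) * (L ^^ (k + n)) (\<lambda>_. 1) x"
        unfolding normalized_iterate_def[of k] iterate_scale iterate_add_apply ..
      then show ?thesis
        using iterate_one_pos[of n x] eigenvalue_pos
        by (simp add: normalized_iterate_def power_add add.commute mult_ac)
    qed
    ultimately have "\<bar>normalized_iterate (n + k) x - normalized_iterate n x\<bar>
      \<le> e / (2 * K) * \<bar>normalized_iterate n x\<bar>"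
      using mult_right_mono[of "\<bar>ratio n (normalized_iterate k) x - 1\<bar>" "e / (2 * K)" "\<bar>normalized_iterate n x\<bar>"]
      by (simp only: abs_mult[symmetric] left_diff_distrib) simp
    also have "\<bar>normalized_iterate n x\<bar> \<le> K"
    proof -
      have "0 < 1 / K" using K(1) by simp
      then show ?thesis using K(2) by (smt (verit))
    qed
    then have "e / (2 * K) * \<bar>normalized_iterate n x\<bar> \<le> e / (2 * K) * K"
      using e K(1) by (intro mult_left_mono) auto
    also have "\<dots> < e" using e K(1) by simp
    finally show ?thesis .
  qed
  show "\<exists>M. \<forall>x\<in>UNIV. \<forall>m\<ge>M. \<forall>n>m. dist (normalized_iterate m x) (normalized_iterate n x) < e"
  proof (intro exI[of _ N] ballI allI impI)
    fix x m n assume "N \<le> m" "m < n"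
    then show "dist (normalized_iterate m x) (normalized_iterate n x) < e"
      using close[of m "n - m" x] by (simp add: dist_real_def abs_minus_commute)
  qed
qed

definition eigenfunction :: "(nat \<Rightarrow> 'a) \<Rightarrow> real" where
  "eigenfunction x = lim (\<lambda>n. normalized_iterate n x)"

lemma normalized_iterate_uniform_limit:
  "uniform_limit UNIV normalized_iterate eigenfunction sequentially"
  using normalized_iterate_uniformly_convergent
  unfolding uniformly_convergent_uniform_limit_iff eigenfunction_def .

lemma normalized_iterate_limit: "(\<lambda>n. normalized_iterate n x) \<longlonglongrightarrow> eigenfunction x"
  by (rule tendsto_uniform_limitI[OF normalized_iterate_uniform_limit]) simp

lemma eigenfunction_cont: "continuous_on UNIV eigenfunction"
  using uniform_limit_theorem[OF _ normalized_iterate_uniform_limit] normalized_iterate_cont by simp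

lemma eigenfunction_pos: "0 < eigenfunction x"
proof -
  obtain K where K: "1 \<le> K" "\<forall>n x. 1 / K \<le> normalized_iterate n x \<and> normalized_iterate n x \<le> K"
    by (rule normalized_iterate_bounds)
  then have "1 / K \<le> eigenfunction x"
    by (intro LIMSEQ_le_const[OF normalized_iterate_limit]) blast
  then show ?thesis using K(1) by (smt (verit) divide_pos_pos)
qed

lemma ruelle_eigenfunction: "L eigenfunction x = eigenvalue * eigenfunction x"
proof (rule LIMSEQ_unique)
  obtain K where K: "1 \<le> K" "\<forall>n x. 1 / K \<le> normalized_iterate n x \<and> normalized_iterate n x \<le> K"
    by (rule normalized_iterate_bounds)
  obtain F where F: "\<forall>x. \<bar>f x\<bar> \<le> F" by (rule potential_bounded)
  show "(\<lambda>n. L (normalized_iterate n) x) \<longlonglongrightarrow> L eigenfunction x"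
    unfolding ruelle_def
  proof (rule integral_dominated_convergence[where w = "\<lambda>_. exp F * K"])
    show "AE a in \<mu>. norm (exp (f (cons_seq a x)) * normalized_iterate n (cons_seq a x)) \<le> exp F * K" for n
    proof (intro AE_I2)
      fix a
      have "0 < 1 / K" using K(1) by simp
      then have "\<bar>normalized_iterate n (cons_seq a x)\<bar> \<le> K" using K(2) by (smt (verit))
      moreover have "exp (f (cons_seq a x)) \<le> exp F"
        using spec[OF F, of "cons_seq a x"] by simp
      ultimately show "norm (exp (f (cons_seq a x)) * normalized_iterate n (cons_seq a x)) \<le> exp F * K"
        by (auto simp: abs_mult intro!: mult_mono)
    qed
    show "AE a in \<mu>. (\<lambda>n. exp (f (cons_seq a x)) * normalized_iterate n (cons_seq a x))
        \<longlonglongrightarrow> exp (f (cons_seq a x)) * eigenfunction (cons_seq a x)"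
      by (intro AE_I2 tendsto_intros normalized_iterate_limit)
  qed (auto intro!: borel_measurable_integrable integrable_ruelle eigenfunction_cont normalized_iterate_cont)
  show "(\<lambda>n. L (normalized_iterate n) x) \<longlonglongrightarrow> eigenvalue * eigenfunction x"
    unfolding ruelle_normalized_iterate
    by (intro tendsto_intros LIMSEQ_Suc normalized_iterate_limit)
qed

section \<open>Uniform convergence and uniqueness of the eigenmeasure\<close>

lemma iterate_converges:
  assumes \<phi>: "continuous_on UNIV \<phi>" and "0 < e"
  shows "\<exists>N. \<forall>n\<ge>N. \<forall>x. \<bar>(L ^^ n) \<phi> x / eigenvalue ^ n - eigenfunction x * eigenfunctional \<phi>\<bar> \<le> e"
proof -
  obtain K where K: "1 \<le> K" "\<forall>n x. 1 / K \<le> normalized_iterate n x \<and> normalized_iterate n x \<le> K"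
    by (rule normalized_iterate_bounds)
  \<comment> \<open>The summand 1 keeps the division by \<open>2 * E\<close> meaningful when the
    functional vanishes at \<open>\<phi>\<close>.\<close>
  define E where "E = \<bar>eigenfunctional \<phi>\<bar> + 1"
  have E: "0 < E" by (simp add: E_def)
  obtain N1 where N1: "\<forall>n\<ge>N1. \<forall>x. \<bar>ratio n \<phi> x - eigenfunctional \<phi>\<bar> \<le> e / (2 * K)"
    using ratio_uniform_limit[OF \<phi>, of "e / (2 * K)"] \<open>0 < e\<close> K(1) by auto
  have "\<forall>\<^sub>F n in sequentially. \<forall>x\<in>UNIV. dist (normalized_iterate n x) (eigenfunction x) < e / (2 * E)"
    using \<open>0 < e\<close> E by (intro uniform_limitD[OF normalized_iterate_uniform_limit]) simp
  then obtain N2 where N2: "\<forall>n\<ge>N2. \<forall>x. dist (normalized_iterate n x) (eigenfunction x) < e / (2 * E)"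
    by (auto simp: eventually_sequentially)
  show ?thesis
  proof (intro exI[of _ "max N1 N2"] allI impI)
    fix n x assume n: "max N1 N2 \<le> n"
    have "0 < 1 / K" using K(1) by simp
    then have hK: "\<bar>normalized_iterate n x\<bar> \<le> K" using K(2) by (smt (verit))
    have split: "(L ^^ n) \<phi> x / eigenvalue ^ n - eigenfunction x * eigenfunctional \<phi>
      = (ratio n \<phi> x - eigenfunctional \<phi>) * normalized_iterate n x
        + eigenfunctional \<phi> * (normalized_iterate n x - eigenfunction x)"
      unfolding iterate_eq_ratio by (simp only: left_diff_distrib right_diff_distrib) simp
    have "\<bar>(L ^^ n) \<phi> x / eigenvalue ^ n - eigenfunction x * eigenfunctional \<phi>\<bar>
      \<le> \<bar>ratio n \<phi> x - eigenfunctional \<phi>\<bar> * \<bar>normalized_iterate n x\<bar>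
        + \<bar>eigenfunctional \<phi>\<bar> * \<bar>normalized_iterate n x - eigenfunction x\<bar>"
      unfolding split abs_mult[symmetric] by (rule abs_triangle_ineq)
    also have "\<dots> \<le> e / (2 * K) * K + E * (e / (2 * E))"
    proof (rule add_mono)
      have "\<bar>ratio n \<phi> x - eigenfunctional \<phi>\<bar> \<le> e / (2 * K)"
        by (rule N1[rule_format]) (use n in simp)
      then show "\<bar>ratio n \<phi> x - eigenfunctional \<phi>\<bar> * \<bar>normalized_iterate n x\<bar> \<le> e / (2 * K) * K"
        using hK \<open>0 < e\<close> K(1) by (intro mult_mono) auto
      have "\<bar>normalized_iterate n x - eigenfunction x\<bar> \<le> e / (2 * E)"
        by (rule less_imp_le, rule N2[rule_format, unfolded dist_real_def]) (use n in simp_all)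
      then show "\<bar>eigenfunctional \<phi>\<bar> * \<bar>normalized_iterate n x - eigenfunction x\<bar> \<le> E * (e / (2 * E))"
        by (intro mult_mono) (auto simp: E_def)
    qed
    also have "\<dots> = e" using K(1) E by simp
    finally show "\<bar>(L ^^ n) \<phi> x / eigenvalue ^ n - eigenfunction x * eigenfunctional \<phi>\<bar> \<le> e" .
  qed
qed

lemma dual_eigen_riesz_measure: "dual_eigen \<mu> f eigenvalue riesz_measure"
  unfolding dual_eigen_def cont_Omega_iff[OF compact_alphabet]
  by (simp add: integral_riesz_measure ruelle_cont eigenfunctional_ruelle)

text \<open>An eigenmeasure \<open>N\<close> gives \<open>L ^^ n \<phi> / eigenvalue ^ n\<close> the
  same integral as \<open>\<phi>\<close> for all \<open>n\<close>. By uniform convergence the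
  integral of \<open>\<phi>\<close> is \<open>eigenfunctional \<phi>\<close> times that of the
  eigenfunction, and taking \<open>\<phi>\<close> constantly 1 shows that the latter factor is
  1.\<close>

lemma dual_eigen_unique:
  assumes N: "prob_space N" "sets N = sets borel" and dual: "dual_eigen \<mu> f eigenvalue N"
  shows "N = riesz_measure"
proof (rule measure_eqI_continuous[OF N(1) prob_space_riesz_measure N(2) sets_riesz_measure])
  interpret N: prob_space N by fact
  have int: "integrable N \<phi>" if "continuous_on UNIV \<phi>" for \<phi> :: "(nat \<Rightarrow> 'a) \<Rightarrow> real"
    by (rule integrable_continuous_compact_UNIV[OF compact_sequences that N.finite_measure_axioms N(2)])
  have iterate: "(\<integral>x. (L ^^ n) \<phi> x \<partial>N) = eigenvalue ^ n * (\<integral>x. \<phi> x \<partial>N)" if "continuous_on UNIV \<phi>" for n \<phi>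
  proof (induction n)
    case (Suc n)
    then show ?case
      using dual iterate_cont[OF that] unfolding dual_eigen_def cont_Omega_iff[OF compact_alphabet] by simp
  qed simp
  have eq: "(\<integral>x. \<phi> x \<partial>N) = eigenfunctional \<phi> * (\<integral>x. eigenfunction x \<partial>N)" if \<phi>: "continuous_on UNIV \<phi>" for \<phi>
  proof -
    have "\<bar>(\<integral>x. \<phi> x \<partial>N) - eigenfunctional \<phi> * (\<integral>x. eigenfunction x \<partial>N)\<bar> \<le> 0 + e" if e: "0 < e" for e :: real
    proof -
      obtain n where n: "\<forall>x. \<bar>(L ^^ n) \<phi> x / eigenvalue ^ n - eigenfunction x * eigenfunctional \<phi>\<bar> \<le> e"
        using iterate_converges[OF \<phi> e] by blast
      have i1: "integrable N (\<lambda>x. (L ^^ n) \<phi> x / eigenvalue ^ n)"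
        and i2: "integrable N (\<lambda>x. eigenfunction x * eigenfunctional \<phi>)"
        using int[OF iterate_cont[OF \<phi>]] int[OF eigenfunction_cont] by auto
      have diff_eq: "(\<integral>x. \<phi> x \<partial>N) - eigenfunctional \<phi> * (\<integral>x. eigenfunction x \<partial>N)
        = (\<integral>x. (L ^^ n) \<phi> x / eigenvalue ^ n - eigenfunction x * eigenfunctional \<phi> \<partial>N)"
        using eigenvalue_pos by (simp add: Bochner_Integration.integral_diff[OF i1 i2] iterate[OF \<phi>] mult.commute)
      have "\<bar>(\<integral>x. \<phi> x \<partial>N) - eigenfunctional \<phi> * (\<integral>x. eigenfunction x \<partial>N)\<bar>
        \<le> (\<integral>x. \<bar>(L ^^ n) \<phi> x / eigenvalue ^ n - eigenfunction x * eigenfunctional \<phi>\<bar> \<partial>N)"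
        unfolding diff_eq by (rule integral_abs_bound)
      also have "\<dots> \<le> (\<integral>x. e \<partial>N)"
        using n by (intro integral_mono integrable_abs Bochner_Integration.integrable_diff i1 i2) auto
      also have "\<dots> = 0 + e" using N.prob_space by simp
      finally show ?thesis .
    qed
    then have "\<bar>(\<integral>x. \<phi> x \<partial>N) - eigenfunctional \<phi> * (\<integral>x. eigenfunction x \<partial>N)\<bar> \<le> 0"
      by (rule field_le_epsilon)
    then show ?thesis by simp
  qed
  have "(\<integral>x. eigenfunction x \<partial>N) = 1"
    using eq[of "\<lambda>_. 1"] one N.prob_space by simp
  then show "(\<integral>x. \<phi> x \<partial>N) = (\<integral>x. \<phi> x \<partial>riesz_measure)" if "continuous_on UNIV \<phi>" for \<phi> :: "(nat \<Rightarrow> 'a) \<Rightarrow> real"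
    using eq[OF that] integral_riesz_measure[OF that] by simp
qed

end

theorem mainTheorem9:
  fixes \<mu> :: "'a::metric_space measure" and f :: "(nat \<Rightarrow> 'a) \<Rightarrow> real"
  assumes "compact (UNIV :: 'a set)"
    and "prob_space \<mu>" and "sets \<mu> = sets borel"
    and "full_support \<mu>"
    and "cont_Omega f" and "weak_walters f"
  shows "\<exists>lam h \<nu>. lam > 0 \<and> cont_Omega h \<and> (\<forall>x. h x > 0) \<and> borel_prob_Omega \<nu>
     \<and> (\<forall>x. ruelle \<mu> f h x = lam * h x) \<and> dual_eigen \<mu> f lam \<nu>
     \<and> (\<forall>\<phi>. cont_Omega \<phi> \<longrightarrow> (\<forall>e>0. \<exists>N. \<forall>n\<ge>N. \<forall>x.
           \<bar>((ruelle \<mu> f ^^ n) \<phi> x) / lam ^ n - h x * (\<integral>y. \<phi> y \<partial>\<nu>)\<bar> \<le> e))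
     \<and> (\<forall>\<nu>'. borel_prob_Omega \<nu>' \<and> dual_eigen \<mu> f lam \<nu>' \<longrightarrow> \<nu>' = \<nu>)"
proof -
  interpret ruelle_operator \<mu> f
    using assms by (intro ruelle_operator.intro) (simp_all add: cont_Omega_iff)
  show ?thesis
  proof (intro exI[of _ eigenvalue] exI[of _ eigenfunction] exI[of _ riesz_measure] conjI allI impI)
    show "borel_prob_Omega riesz_measure"
      by (simp add: borel_prob_Omega_def prob_space_riesz_measure borel_Omega_eq_borel[OF assms(1)])
    show "\<exists>N. \<forall>n\<ge>N. \<forall>x. \<bar>(L ^^ n) \<phi> x / eigenvalue ^ n - eigenfunction x * (\<integral>y. \<phi> y \<partial>riesz_measure)\<bar> \<le> e"
      if "cont_Omega \<phi>" "0 < e" for \<phi> e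
      using that iterate_converges[of \<phi> e] by (simp add: cont_Omega_iff[OF assms(1)] integral_riesz_measure)
    show "\<nu>' = riesz_measure" if "borel_prob_Omega \<nu>' \<and> dual_eigen \<mu> f eigenvalue \<nu>'" for \<nu>'
      using that dual_eigen_unique[of \<nu>'] by (simp add: borel_prob_Omega_def borel_Omega_eq_borel[OF assms(1)])
  qed (simp_all add: eigenvalue_pos eigenfunction_pos eigenfunction_cont cont_Omega_iff[OF assms(1)]
      ruelle_eigenfunction dual_eigen_riesz_measure)
qed

end
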